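(* There exist universal constants $C>0$ and $p>0$ such that the following holds. Let $1\le r\le d$ be integers, $a$ a positive integer, $\alpha>0$, let $\kappa\in[1,2)$, set $\varepsilon'=\kappa-1\in[0,1)$, and let $\varepsilon\in(0,1)$ satisfy $\varepsilon\ge\varepsilon'$. There is a query algorithm (depending only on $d,r,a,\alpha,\kappa,\varepsilon$) such that, for every rank-$r$ density matrix $\rho$ on $\mathbb{C}^d$ with condition number $\lambda_{\max}(\rho)/\lambda_{\min}(\rho)=\kappa$ and every $(\alpha,a,0)$-block encoding $U_\rho$ of $\rho$, the algorithm makes at most $$C\,\frac{\alpha}{\lambda_{\max}(\rho)}\sqrt{\frac{d}{r}}$$ queries in total to $\mathcal{U}_\rho$ and $\mathcal{U}_\rho^\dagger$ and, with success probability at least $p$, outputs a state $\hat\rho$ with $\|\hat\rho-\rho\|_1\le\varepsilon$. Here $\lambda_{\max}(\rho)$ is the largest eigenvalue of $\rho$ and $\lambda_{\min}(\rho)$ is its smallest nonzero eigenvalue.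
   Context: Block encoding: a unitary $U$ on $(\mathbb{C}^2)^{\otimes a}\otimes\mathbb{C}^d$ is an $(\alpha,a,0)$-block encoding of an operator $A$ on $\mathbb{C}^d$ if $\alpha(\langle 0|^{\otimes a}\otimes I)U(|0\rangle^{\otimes a}\otimes I)=A$. For a unitary $U_\rho$, put $\mathcal{U}_\rho(\cdot)=U_\rho(\cdot)U_\rho^\dagger$ and $\mathcal{U}_\rho^\dagger(\cdot)=U_\rho^\dagger(\cdot)U_\rho$. $\|\cdot\|_1$ is the trace norm. A query algorithm prepares a fixed initial state on a finite-dimensional workspace, applies a sequence of fixed unitary channels (independent of the unknown $\rho$ and $U_\rho$) interleaved with uses (queries) of $\mathcal{U}_\rho$ and $\mathcal{U}_\rho^\dagger$, performs a fixed measurement on part of the workspace with a binary outcome success/failure, and outputs the state of a designated $d$-dimensional subsystem. "With success probability at least $p$ outputs $\hat\rho$" means the outcome "success" occurs with probability at least $p$ and, conditioned on it, the output state is $\hat\rho$. *)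

theory Defs
  imports
    "Jordan_Normal_Form.Spectral_Radius"
    "Jordan_Normal_Form.Schur_Decomposition"
    "Jordan_Normal_Form.DL_Rank"
begin

definition mat_trace :: "complex mat \<Rightarrow> complex" where
  "mat_trace A = (\<Sum>i<dim_row A. A $$ (i, i))"

definition unitary_mat :: "nat \<Rightarrow> complex mat \<Rightarrow> bool" where
  "unitary_mat n U \<longleftrightarrow> U \<in> carrier_mat n n \<and>
     mat_adjoint U * U = 1\<^sub>m n \<and> U * mat_adjoint U = 1\<^sub>m n"

text \<open>The order on complex numbers used here makes \<open>0 \<le> z\<close> mean that \<open>z\<close> is real and
  nonnegative.\<close>

definition psd_mat :: "nat \<Rightarrow> complex mat \<Rightarrow> bool" where
  "psd_mat n A \<longleftrightarrow> A \<in> carrier_mat n n \<and> mat_adjoint A = A \<and>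
     (\<forall>v \<in> carrier_vec n. 0 \<le> (A *\<^sub>v v) \<bullet>c v)"

definition density_mat :: "nat \<Rightarrow> complex mat \<Rightarrow> bool" where
  "density_mat n \<rho> \<longleftrightarrow> psd_mat n \<rho> \<and> mat_trace \<rho> = 1"

text \<open>Sum of the singular values of \<open>A\<close>: the square roots of the eigenvalues of
  \<open>A\<^sup>\<dagger> A\<close>, counted with algebraic multiplicity.\<close>

definition trace_norm :: "complex mat \<Rightarrow> real" where
  "trace_norm A = (\<Sum>x \<in># proots (char_poly (mat_adjoint A * A)). sqrt (Re x))"

text \<open>Largest eigenvalue and smallest nonzero eigenvalue, meant for Hermitian matrices only
  (whose eigenvalues are real).\<close>

definition lambda_max :: "complex mat \<Rightarrow> real" where
  "lambda_max A = Max (Re ` spectrum A)"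

definition lambda_min :: "complex mat \<Rightarrow> real" where
  "lambda_min A = Min (Re ` (spectrum A - {0}))"

text \<open>Tensor product; the basis vector \<open>e\<^sub>i \<otimes> e\<^sub>k\<close> has index \<open>i * n + k\<close>,
  where \<open>n\<close> is the dimension of the second factor.\<close>

definition kron :: "complex mat \<Rightarrow> complex mat \<Rightarrow> complex mat" where
  "kron A B = mat (dim_row A * dim_row B) (dim_col A * dim_col B)
     (\<lambda>(i, j). A $$ (i div dim_row B, j div dim_col B) * B $$ (i mod dim_row B, j mod dim_col B))"

text \<open>Partial trace over the first factor of a tensor product of dimensions \<open>n\<close> and \<open>d\<close>.\<close>

definition ptrace_fst :: "nat \<Rightarrow> nat \<Rightarrow> complex mat \<Rightarrow> complex mat" where
  "ptrace_fst n d A = mat d d (\<lambda>(i, j). \<Sum>k<n. A $$ (k * d + i, k * d + j))"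

definition conj_channel :: "complex mat \<Rightarrow> complex mat \<Rightarrow> complex mat" where
  "conj_channel V \<sigma> = V * \<sigma> * mat_adjoint V"

text \<open>The \<open>a\<close>-qubit state with all qubits in state 0, as a column; it is the first
  basis vector.\<close>

definition ket_zero :: "nat \<Rightarrow> complex mat" where
  "ket_zero a = mat (2 ^ a) 1 (\<lambda>(i, j). if i = 0 then 1 else 0)"

text \<open>Exact block encodings, i.e. the case of error \<open>0\<close>.\<close>

definition block_encoding :: "nat \<Rightarrow> real \<Rightarrow> nat \<Rightarrow> complex mat \<Rightarrow> complex mat \<Rightarrow> bool" where
  "block_encoding d \<alpha> a U A \<longleftrightarrow> unitary_mat (2 ^ a * d) U \<and>
     complex_of_real \<alpha> \<cdot>\<^sub>m
       (kron (mat_adjoint (ket_zero a)) (1\<^sub>m d) * U * kron (ket_zero a) (1\<^sub>m d)) = A"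

text \<open>The workspace is an ancilla of dimension \<open>anc_dim\<close>, followed by \<open>a\<close> qubits, followed by
  a \<open>d\<close>-dimensional system. Queries act on the last two factors. The last factor is the output;
  the success measurement acts on the remaining factors, and \<open>success_effect\<close> is its POVM
  element for the outcome success. Other placements of the measured and the output subsystem
  are obtained by enlarging the ancilla and appending a fixed unitary.\<close>

datatype alg_step = Fixed "complex mat" | Query | Query_Adjoint

record query_algorithm =
  anc_dim :: nat
  init_state :: "complex mat"
  steps :: "alg_step list"
  success_effect :: "complex mat"

definition rest_dim :: "nat \<Rightarrow> query_algorithm \<Rightarrow> nat" where
  "rest_dim a alg = anc_dim alg * 2 ^ a"

definition valid_algorithm :: "nat \<Rightarrow> nat \<Rightarrow> query_algorithm \<Rightarrow> bool" where
  "valid_algorithm d a alg \<longleftrightarrow>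
     anc_dim alg > 0 \<and>
     density_mat (rest_dim a alg * d) (init_state alg) \<and>
     (\<forall>V. Fixed V \<in> set (steps alg) \<longrightarrow> unitary_mat (rest_dim a alg * d) V) \<and>
     psd_mat (rest_dim a alg) (success_effect alg) \<and>
     psd_mat (rest_dim a alg) (1\<^sub>m (rest_dim a alg) - success_effect alg)"

definition query_count :: "query_algorithm \<Rightarrow> nat" where
  "query_count alg = length (filter (\<lambda>s. s = Query \<or> s = Query_Adjoint) (steps alg))"

fun apply_step :: "nat \<Rightarrow> complex mat \<Rightarrow> alg_step \<Rightarrow> complex mat \<Rightarrow> complex mat" where
  "apply_step m U (Fixed V) \<sigma> = conj_channel V \<sigma>"
| "apply_step m U Query \<sigma> = conj_channel (kron (1\<^sub>m m) U) \<sigma>"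
| "apply_step m U Query_Adjoint \<sigma> = conj_channel (kron (1\<^sub>m m) (mat_adjoint U)) \<sigma>"

definition final_state :: "query_algorithm \<Rightarrow> complex mat \<Rightarrow> complex mat" where
  "final_state alg U = fold (apply_step (anc_dim alg) U) (steps alg) (init_state alg)"

definition success_prob :: "nat \<Rightarrow> query_algorithm \<Rightarrow> complex mat \<Rightarrow> real" where
  "success_prob d alg U =
     Re (mat_trace (kron (success_effect alg) (1\<^sub>m d) * final_state alg U))"

text \<open>The reduced state of the output system conditioned on success. The measurement does not
  act on the output system, so this depends only on the POVM element.\<close>

definition output_state :: "nat \<Rightarrow> nat \<Rightarrow> query_algorithm \<Rightarrow> complex mat \<Rightarrow> complex mat" where
  "output_state d a alg U =
     complex_of_real (1 / success_prob d alg U) \<cdot>\<^sub>m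
       ptrace_fst (rest_dim a alg) d (kron (success_effect alg) (1\<^sub>m d) * final_state alg U)"

end

(* Let psi be the maximally entangled state of the ancilla and the system, with all qubits in
   state 0. Projecting (1 (x) U) psi onto qubit state 0 gives the vector of rho / (alpha sqrt d),
   whose reduced state on the system is proportional to rho^2 and whose squared norm is
   sin^2 theta = S / (alpha^2 d) with S = tr (rho^2). Amplitude amplification rescales this component
   without changing its direction, so the output conditioned on success is exactly rho^2 / S for every
   number of rounds. S is the mean of the nonzero eigenvalues of rho, weighted by themselves, and these
   lie in [lambda_min, kappa * lambda_min], whence ||rho^2 / S - rho||_1 <= kappa - 1. Finally
   lambda_max lies between 1/r and kappa/r, so the angle theta is known up to a constant factor from
   alpha, r and d alone, and the number of rounds can be fixed in advance. *)

theory Submission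
  imports Defs "Jordan_Normal_Form.Jordan_Normal_Form_Uniqueness"
begin

section \<open>Rank and spectrum of Hermitian matrices\<close>

text \<open>No eigenbasis of \<rho> is used. Traces and \<open>trace_norm\<close> depend only on the
  roots of characteristic polynomials, so one triangular form of \<rho> suffices: \<rho>, its square
  and every combination of the two become triangular together, with their eigenvalues on the
  diagonal. The rank is the exception, since a nilpotent part is invisible there; it needs that a
  Hermitian matrix has no nontrivial Jordan block for 0. The obstacle in the amplification is
  overshooting, as \<theta> is known only within a constant factor. The amplified angle is therefore
  aimed at 1 at most rather than at pi / 2, and its sine is then bounded below by half the angle. If
  the initial angle is already large, no round is made. The unwanted component of the state needs no
  control, because the success effect annihilates it.\<close>

lemma rank_plus_kernel_dim:
  fixes A :: "'a :: field mat"
  assumes A: "A \<in> carrier_mat n n"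
  shows "vec_space.rank n A + kernel_dim A = n"
proof -
  interpret vec_space "TYPE('a)" n .
  let ?T = "\<lambda>v. A *\<^sub>v v"
  have hom: "mod_hom class_ring V V ?T"
  proof (rule mod_hom.intro, unfold mod_hom_axioms_def)
    show "Module.module class_ring V" by intro_locales
    show "Module.module class_ring V" by intro_locales
    show "?T \<in> LinearCombinations.module_hom class_ring V V"
      unfolding LinearCombinations.module_hom_def
      using A by (auto simp: mult_add_distrib_mat_vec mult_mat_vec)
  qed
  have "vectorspace class_ring V" by intro_locales
  then have lin: "linear_map class_ring V V ?T"
    using hom unfolding linear_map_def by blast
  have im: "mod_hom.im V ?T = span (set (cols A))"
    unfolding mod_hom.im_def[OF hom] col_space_def[symmetric]
    using col_space_eq[OF A] A by auto
  have ker: "mod_hom.ker V V ?T = mat_kernel A"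
    unfolding mod_hom.ker_def[OF hom] mat_kernel[OF A] by auto
  have kd: "kernel_dim A = vectorspace.dim class_ring (vs (mat_kernel A))"
    unfolding kernel_dim_def using A by simp
  show ?thesis
    using linear_map.rank_nullity[OF lin fin_dim]
    unfolding im ker kd rank_def dim_is_n .
qed

section \<open>Adjoints, kernels and the rank of a Hermitian matrix\<close>

lemma mat_adjoint_eq:
  "mat_adjoint A = mat (dim_col A) (dim_row A) (\<lambda>(i, j). conjugate (A $$ (j, i)))"
  by (intro eq_matI) (auto simp: mat_adjoint_def mat_of_rows_index)

lemma mat_adjoint_carrier: "A \<in> carrier_mat n m \<Longrightarrow> mat_adjoint A \<in> carrier_mat m n"
  by (simp add: mat_adjoint_eq)

lemma mat_adjoint_mult:
  fixes A B :: "'a :: conjugatable_field mat"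
  assumes "A \<in> carrier_mat n m" "B \<in> carrier_mat m k"
  shows "mat_adjoint (A * B) = mat_adjoint B * mat_adjoint A"
  using assms
  by (intro eq_matI)
    (auto simp: mat_adjoint_eq scalar_prod_def sum_conjugate conjugate_dist_mul mult.commute)

lemma mat_adjoint_minus:
  fixes A B :: "'a :: conjugatable_field mat"
  assumes "A \<in> carrier_mat n m" "B \<in> carrier_mat n m"
  shows "mat_adjoint (A - B) = mat_adjoint A - mat_adjoint B"
  using assms by (intro eq_matI) (auto simp: mat_adjoint_eq conjugate_dist_add conjugate_neg minus_mat_def diff_conv_add_uminus simp del: add_uminus_conv_diff)

lemma mat_adjoint_smult:
  fixes A :: "'a :: conjugatable_field mat"
  shows "mat_adjoint (c \<cdot>\<^sub>m A) = conjugate c \<cdot>\<^sub>m mat_adjoint A"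
  by (intro eq_matI) (auto simp: mat_adjoint_eq conjugate_dist_mul)

lemma adjoint_scalar_prod:
  fixes A :: "'a :: conjugatable_field mat"
  assumes A: "A \<in> carrier_mat n m" and x: "x \<in> carrier_vec m" and y: "y \<in> carrier_vec n"
  shows "(A *\<^sub>v x) \<bullet>c y = x \<bullet>c (mat_adjoint A *\<^sub>v y)"
proof -
  have "(A *\<^sub>v x) \<bullet>c y = (\<Sum>i<n. \<Sum>j<m. A $$ (i, j) * x $ j * conjugate (y $ i))"
    using A x y by (simp add: scalar_prod_def sum_distrib_right atLeast0LessThan)
  also have "\<dots> = (\<Sum>j<m. \<Sum>i<n. A $$ (i, j) * x $ j * conjugate (y $ i))"
    by (rule sum.swap)
  also have "\<dots> = x \<bullet>c (mat_adjoint A *\<^sub>v y)"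
    using A x y
    by (simp add: scalar_prod_def sum_conjugate conjugate_dist_mul mat_adjoint_eq
        sum_distrib_left atLeast0LessThan mult_ac)
  finally show ?thesis .
qed

text \<open>If A A v = 0, then the squared norm of A v equals the inner product of v with A A v,
  which is 0.\<close>

lemma hermitian_kernel_square:
  fixes A :: "complex mat"
  assumes A: "A \<in> carrier_mat n n" and herm: "mat_adjoint A = A"
  shows "mat_kernel (A * A) = mat_kernel A"
proof -
  have "A *\<^sub>v v = 0\<^sub>v n" if v: "v \<in> carrier_vec n" and 0: "A *\<^sub>v (A *\<^sub>v v) = 0\<^sub>v n" for v
  proof -
    have Av: "A *\<^sub>v v \<in> carrier_vec n" using A v by simp
    have "(A *\<^sub>v v) \<bullet>c (A *\<^sub>v v) = v \<bullet>c (A *\<^sub>v (A *\<^sub>v v))"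
      using adjoint_scalar_prod[OF A v Av] herm by simp
    also have "\<dots> = 0" unfolding 0 using v by (simp add: conjugate_zero_vec)
    finally show ?thesis using Av by (simp add: conjugate_square_eq_0_vec)
  qed
  then show ?thesis
    using A by (auto simp: mat_kernel[of _ n n] assoc_mult_mat_vec[of _ n n _ n])
qed

text \<open>As \<open>A\<close> and \<open>A\<^sup>2\<close> have the same kernel, all Jordan blocks for the eigenvalue 0 have size 1.\<close>

lemma hermitian_order_0_char_poly:
  fixes A :: "complex mat"
  assumes A: "A \<in> carrier_mat n n" and herm: "mat_adjoint A = A"
  shows "Polynomial.order 0 (char_poly A) = kernel_dim A"
proof -
  from char_poly_factorized[OF A] obtain es where "char_poly A = (\<Prod>e\<leftarrow>es. [:- e, 1:])"
    by blast
  from jordan_nf_exists[OF A this] obtain bs where bs: "jordan_nf A bs" by blast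
  define ns where "ns = map fst [(m, e)\<leftarrow>bs. e = 0]"
  have cm: "char_matrix A 0 = A" using A by (auto simp: char_matrix_def)
  have ker: "kernel_dim (A * A) = kernel_dim A"
    using hermitian_kernel_square[OF A herm] A unfolding kernel_dim_def by simp
  \<comment> \<open>A Jordan block of size m for the eigenvalue 0 contributes min k m to the kernel
    dimension of the k-th power of A. The powers 1 and 2 are compared.\<close>
  have d1: "kernel_dim A = (\<Sum>m\<leftarrow>ns. min 1 m)"
    using dim_gen_eigenspace[OF bs, of 0 1] A unfolding dim_gen_eigenspace_def cm ns_def by simp
  have d2: "kernel_dim A = (\<Sum>m\<leftarrow>ns. min 2 m)"
    using dim_gen_eigenspace[OF bs, of 0 2] A ker
    unfolding dim_gen_eigenspace_def cm ns_def by (simp add: numeral_2_eq_2)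
  have "0 \<notin> set ns" using bs unfolding jordan_nf_def ns_def by force
  moreover have "(\<Sum>m\<leftarrow>ns. min 1 m) = (\<Sum>m\<leftarrow>ns. min 2 m)" using d1 d2 by simp
  ultimately have "(\<Sum>m\<leftarrow>ns. min 1 m) = sum_list ns"
  \<comment> \<open>The two sums are ordered termwise, so their equality forces equality in each
    term. This excludes m \<ge> 2, and m = 0 is already excluded.\<close>
  proof (induction ns)
    case (Cons m ns)
    have "(\<Sum>m\<leftarrow>ns. min 1 m) \<le> (\<Sum>m\<leftarrow>ns. min 2 m)"
      by (rule sum_list_mono) simp
    then show ?case using Cons by (auto simp: min_def split: if_splits)
  qed simp
  moreover have "Polynomial.order 0 (char_poly A) = sum_list ns"
    unfolding jordan_nf_order[OF bs] ns_def by (simp add: case_prod_beta')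
  ultimately show ?thesis using d1 by simp
qed

lemma proots_linear_factors: "proots (\<Prod>e\<leftarrow>es. [:- e, 1:]) = mset (es :: 'a :: field list)"
proof (induction es)
  case (Cons e es)
  have "(\<Prod>e\<leftarrow>es. [:- e, 1:]) \<noteq> 0" by (auto simp: prod_list_zero_iff)
  then show ?case using Cons by (simp add: proots_mult del: mult_pCons_left)
qed simp

lemma char_poly_nonzero:
  fixes A :: "'a :: comm_ring_1 mat"
  assumes "A \<in> carrier_mat n n"
  shows "char_poly A \<noteq> 0"
proof
  assume "char_poly A = 0"
  then show False using degree_monic_char_poly[OF assms] by simp
qed

lemma size_proots_char_poly:
  assumes A: "(A :: complex mat) \<in> carrier_mat n n"
  shows "size (proots (char_poly A)) = n"
proof -
  from char_poly_factorized[OF A] obtain es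
    where "char_poly A = (\<Prod>e\<leftarrow>es. [:- e, 1:])" "length es = n" by blast
  then show ?thesis by (simp only: proots_linear_factors size_mset)
qed

text \<open>Links the geometric rank in the theorem to eigenvalues counted with algebraic
  multiplicity. Hermitian symmetry is essential: a nilpotent matrix can have positive rank and no
  nonzero root.\<close>

lemma hermitian_rank_eq_size:
  fixes A :: "complex mat"
  assumes A: "A \<in> carrier_mat n n" and herm: "mat_adjoint A = A"
  shows "vec_space.rank n A = size {#e \<in># proots (char_poly A). e \<noteq> 0#}"
proof -
  let ?E = "proots (char_poly A)"
  have "size {#e \<in># ?E. \<not> e \<noteq> 0#} = kernel_dim A"
    using hermitian_order_0_char_poly[OF A herm] char_poly_nonzero[OF A]
    by (simp add: filter_eq_replicate_mset)
  moreover have "size ?E = size {#e \<in># ?E. e \<noteq> 0#} + size {#e \<in># ?E. \<not> e \<noteq> 0#}"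
    using arg_cong[OF multiset_partition[of ?E "\<lambda>e. e \<noteq> 0"], of size] by (simp only: size_union)
  ultimately show ?thesis
    using rank_plus_kernel_dim[OF A] size_proots_char_poly[OF A] by simp
qed

section \<open>Spectral functions through simultaneous triangularisation\<close>

lemma upper_triangular_mult:
  fixes A B :: "'a :: semiring_0 mat"
  assumes A: "A \<in> carrier_mat n n" and B: "B \<in> carrier_mat n n"
    and utA: "upper_triangular A" and utB: "upper_triangular B"
  shows "upper_triangular (A * B)"
    and "i < n \<Longrightarrow> (A * B) $$ (i, i) = A $$ (i, i) * B $$ (i, i)"
proof -
  have entry: "(A * B) $$ (i, j) = (\<Sum>k<n. A $$ (i, k) * B $$ (k, j))" if "i < n" "j < n" for i j
    using that A B by (simp add: scalar_prod_def atLeast0LessThan)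
  have zero: "A $$ (i, k) * B $$ (k, j) = 0" if "i < n" "k < n" "k < i \<or> j < k" for i j k
    using that A B upper_triangularD[OF utA, of k i] upper_triangularD[OF utB, of j k] by auto
  show "upper_triangular (A * B)"
  proof (rule upper_triangularI)
    fix i j assume ij: "j < i" "i < dim_row (A * B)"
    then have "i < n" using A by simp
    then have "A $$ (i, k) * B $$ (k, j) = 0" if "k < n" for k
      using that ij zero[of i k j] by linarith
    then show "(A * B) $$ (i, j) = 0"
      using ij \<open>i < n\<close> entry[of i j] by simp
  qed
  assume i: "i < n"
  have "(\<Sum>k<n. A $$ (i, k) * B $$ (k, i)) = (\<Sum>k\<in>{i}. A $$ (i, k) * B $$ (k, i))"
    using i zero[of i _ i] by (intro sum.mono_neutral_right) (auto, metis nat_neq_iff)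
  then show "(A * B) $$ (i, i) = A $$ (i, i) * B $$ (i, i)"
    using entry[OF i i] by simp
qed

lemma schur_triangular_exists:
  fixes A :: "complex mat"
  assumes A: "A \<in> carrier_mat n n"
  obtains B P Q where "similar_mat_wit A B P Q" "upper_triangular B"
    "mset (diag_mat B) = proots (char_poly A)"
proof -
  from char_poly_factorized[OF A] obtain es
    where es: "char_poly A = (\<Prod>e\<leftarrow>es. [:- e, 1:])" "length es = n" by blast
  obtain B P Q where "schur_decomposition A es = (B, P, Q)" by (cases "schur_decomposition A es")
  from schur_decomposition[OF A es(1) this] es(1) that[of B P Q] show ?thesis
    by (simp only: proots_linear_factors)
qed

lemma mat_trace_mult_comm:
  assumes "A \<in> carrier_mat n m" "B \<in> carrier_mat m n"
  shows "mat_trace (A * B) = mat_trace (B * A)"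
proof -
  have "mat_trace (A * B) = (\<Sum>i<n. \<Sum>j<m. A $$ (i, j) * B $$ (j, i))"
    using assms by (simp add: mat_trace_def scalar_prod_def atLeast0LessThan)
  also have "\<dots> = (\<Sum>j<m. \<Sum>i<n. A $$ (i, j) * B $$ (j, i))" by (rule sum.swap)
  also have "\<dots> = mat_trace (B * A)"
    using assms by (simp add: mat_trace_def scalar_prod_def atLeast0LessThan mult.commute)
  finally show ?thesis .
qed

lemma mat_trace_similar:
  assumes "similar_mat_wit A B P Q"
  shows "mat_trace A = mat_trace B"
proof -
  define n where "n = dim_row A"
  note wit = similar_mat_witD[OF n_def assms]
  have "mat_trace (P * B * Q) = mat_trace (Q * (P * B))"
    by (rule mat_trace_mult_comm[of _ n n]) (use wit in auto)
  also have "Q * (P * B) = Q * P * B"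
    by (rule assoc_mult_mat[symmetric, of _ n n _ n _ n]) (use wit in auto)
  also have "\<dots> = B" using wit by simp
  finally show ?thesis using wit by simp
qed

lemma mat_trace_eq_sum_diag: "mat_trace A = sum_list (diag_mat A)"
  by (simp add: mat_trace_def diag_mat_def interv_sum_list_conv_sum_set_nat atLeast0LessThan)

text \<open>Keeping the same \<open>P\<close> and \<open>Q\<close> is the point: polynomials in one
  matrix are triangularised together, so their eigenvalues can be read off in matching order from
  the diagonal.\<close>

lemma similar_mat_wit_mult:
  fixes A B :: "'a :: comm_ring_1 mat"
  assumes "similar_mat_wit A B P Q" "similar_mat_wit A' B' P Q" "dim_row A = dim_row A'"
  shows "similar_mat_wit (A * A') (B * B') P Q"
proof -
  define n where "n = dim_row A"
  note 1 = similar_mat_witD[OF n_def assms(1)]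
  note 2 = similar_mat_witD[OF n_def[unfolded assms(3)] assms(2)]
  note C = 1(4-7) 2(5)
  have "A * A' = (P * B * Q) * (P * B' * Q)" using 1(3) 2(3) by simp
  also have "\<dots> = (P * B) * (Q * (P * B' * Q))"
    by (rule assoc_mult_mat[of _ n n _ n _ n]) (use C in auto)
  also have "Q * (P * B' * Q) = Q * (P * (B' * Q))"
    by (subst assoc_mult_mat[of P n n B' n Q n]) (use C in auto)
  also have "\<dots> = (Q * P) * (B' * Q)"
    by (rule assoc_mult_mat[symmetric, of _ n n _ n _ n]) (use C in auto)
  also have "\<dots> = B' * Q" using 1(2) C by simp
  also have "(P * B) * (B' * Q) = (P * B) * B' * Q"
    by (rule assoc_mult_mat[symmetric, of _ n n _ n _ n]) (use C in auto)
  also have "(P * B) * B' = P * (B * B')"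
    by (rule assoc_mult_mat[of _ n n _ n _ n]) (use C in auto)
  finally show ?thesis using 1 2 by (intro similar_mat_witI[of _ _ n]) auto
qed

lemma similar_mat_wit_minus:
  fixes A B :: "'a :: comm_ring_1 mat"
  assumes "similar_mat_wit A B P Q" "similar_mat_wit A' B' P Q" "dim_row A = dim_row A'"
  shows "similar_mat_wit (A - A') (B - B') P Q"
proof -
  define n where "n = dim_row A"
  note 1 = similar_mat_witD[OF n_def assms(1)]
  note 2 = similar_mat_witD[OF n_def[unfolded assms(3)] assms(2)]
  have "A - A' = P * B * Q - P * B' * Q" using 1 2 by simp
  also have "\<dots> = P * (B - B') * Q"
    using 1 2 by (simp add: mult_minus_distrib_mat[of _ n n] minus_mult_distrib_mat[of _ n n])
  finally show ?thesis using 1 2 by (intro similar_mat_witI[of _ _ n]) auto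
qed

lemma proots_char_poly_similar_upper_triangular:
  fixes A B :: "complex mat"
  assumes "similar_mat_wit A B P Q" "upper_triangular B"
  shows "proots (char_poly A) = mset (diag_mat B)"
proof -
  have "char_poly A = char_poly B"
    using assms(1) by (intro char_poly_similar) (auto simp: similar_mat_def)
  moreover have "B \<in> carrier_mat (dim_row A) (dim_row A)"
    by (rule similar_mat_witD(5)[OF refl assms(1)])
  ultimately show ?thesis
    using char_poly_upper_triangular[OF _ assms(2)] by (simp add: proots_linear_factors)
qed

lemma mat_trace_eq_sum_proots:
  assumes A: "A \<in> carrier_mat n n"
  shows "mat_trace A = (\<Sum>e\<in>#proots (char_poly A). e)"
    and "mat_trace (A * A) = (\<Sum>e\<in>#proots (char_poly A). e\<^sup>2)"
proof -
  obtain B P Q where wit: "similar_mat_wit A B P Q" and ut: "upper_triangular B"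
    and diag: "mset (diag_mat B) = proots (char_poly A)"
    using schur_triangular_exists[OF A] .
  have B: "B \<in> carrier_mat n n" using similar_mat_witD2[OF A wit] by simp
  have "mat_trace A = sum_list (diag_mat B)"
    using mat_trace_similar[OF wit] by (simp add: mat_trace_eq_sum_diag)
  then show "mat_trace A = (\<Sum>e\<in>#proots (char_poly A). e)"
    by (simp add: diag[symmetric] sum_mset_sum_list)
  have "mat_trace (A * A) = sum_list (diag_mat (B * B))"
    using mat_trace_similar[OF similar_mat_wit_mult[OF wit wit]] by (simp add: mat_trace_eq_sum_diag)
  also have "diag_mat (B * B) = map (\<lambda>e. e\<^sup>2) (diag_mat B)"
    using B upper_triangular_mult(2)[OF B B ut ut]
    by (intro nth_equalityI) (simp_all add: diag_mat_def power2_eq_square del: index_mult_mat(1))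
  finally show "mat_trace (A * A) = (\<Sum>e\<in>#proots (char_poly A). e\<^sup>2)"
    unfolding diag[symmetric] mset_map[symmetric] sum_mset_sum_list .
qed

text \<open>With c real, M = c A A - A is Hermitian, so the matrix in \<open>trace_norm\<close> is M
  M, and the similarity that triangularises A turns it into N N with diagonal entries (c e^2 - e)^2.
  The difference between the output state and \<rho> has exactly this shape, with c = 1 / S.\<close>

lemma trace_norm_hermitian_quadratic:
  assumes A: "A \<in> carrier_mat n n" and herm: "mat_adjoint A = A"
  shows "trace_norm (complex_of_real c \<cdot>\<^sub>m (A * A) - A) =
    (\<Sum>e\<in>#proots (char_poly A). sqrt (Re ((complex_of_real c * e\<^sup>2 - e)\<^sup>2)))"
proof -
  obtain B P Q where wit: "similar_mat_wit A B P Q" and ut: "upper_triangular B"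
    and diag: "mset (diag_mat B) = proots (char_poly A)"
    using schur_triangular_exists[OF A] .
  have B: "B \<in> carrier_mat n n" using similar_mat_witD2[OF A wit] by simp
  define M where "M = complex_of_real c \<cdot>\<^sub>m (A * A) - A"
  define N where "N = complex_of_real c \<cdot>\<^sub>m (B * B) - B"
  have AA: "A * A \<in> carrier_mat n n" and N: "N \<in> carrier_mat n n"
    using A B by (auto simp: N_def)
  have "mat_adjoint M = M"
    unfolding M_def mat_adjoint_minus[OF smult_carrier_mat[OF AA] A] mat_adjoint_smult
      mat_adjoint_mult[OF A A] herm by simp
  moreover have wN: "similar_mat_wit M N P Q"
    unfolding M_def N_def
    by (intro similar_mat_wit_minus similar_mat_wit_smult similar_mat_wit_mult wit) simp_all
  have "similar_mat_wit (M * M) (N * N) P Q"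
    by (intro similar_mat_wit_mult wN refl)
  moreover have utN: "upper_triangular N"
    using upper_triangular_mult(1)[OF B B ut ut] ut B
    by (auto simp: N_def upper_triangular_def)
  moreover have "diag_mat (N * N) = map (\<lambda>e. (complex_of_real c * e\<^sup>2 - e)\<^sup>2) (diag_mat B)"
  proof (rule nth_equalityI)
    show len: "length (diag_mat (N * N)) =
        length (map (\<lambda>e. (complex_of_real c * e\<^sup>2 - e)\<^sup>2) (diag_mat B))"
      using B N by (simp add: diag_mat_def)
    fix i assume "i < length (diag_mat (N * N))"
    then have i: "i < n" using N by (simp add: diag_mat_def)
    have "N $$ (i, i) = complex_of_real c * (B * B) $$ (i, i) - B $$ (i, i)"
      using i B unfolding N_def by simp
    then have "N $$ (i, i) = complex_of_real c * (B $$ (i, i))\<^sup>2 - B $$ (i, i)"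
      unfolding upper_triangular_mult(2)[OF B B ut ut i] by (simp add: power2_eq_square)
    then show "diag_mat (N * N) ! i =
        map (\<lambda>e. (complex_of_real c * e\<^sup>2 - e)\<^sup>2) (diag_mat B) ! i"
      using upper_triangular_mult(2)[OF N N utN utN i] i N B
      by (simp add: diag_mat_def power2_eq_square del: index_mult_mat(1))
  qed
  ultimately have "proots (char_poly (mat_adjoint M * M)) =
      image_mset (\<lambda>e. (complex_of_real c * e\<^sup>2 - e)\<^sup>2) (proots (char_poly A))"
    using upper_triangular_mult(1)[OF N N utN utN]
    unfolding diag[symmetric] mset_map[symmetric]
    by (metis proots_char_poly_similar_upper_triangular)
  then show ?thesis
    unfolding trace_norm_def M_def[symmetric] by (simp add: image_mset.compositionality comp_def)
qed

section \<open>Eigenvalue estimates for a density matrix\<close>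

lemma psd_mat_eigenvalue_nonneg:
  assumes psd: "psd_mat n A" and ev: "eigenvalue A e"
  shows "0 \<le> e"
proof -
  have A: "A \<in> carrier_mat n n" using psd by (simp add: psd_mat_def)
  obtain v where v: "v \<in> carrier_vec n" "v \<noteq> 0\<^sub>v n" "A *\<^sub>v v = e \<cdot>\<^sub>v v"
    using ev A by (auto simp: eigenvalue_def eigenvector_def)
  have "0 \<le> e * (v \<bullet>c v)" using psd v by (auto simp: psd_mat_def)
  moreover have "0 < v \<bullet>c v"
    using v conjugate_square_greater_0_vec[of v n] by simp
  ultimately show ?thesis
    by (auto simp: less_eq_complex_def less_complex_def zero_le_mult_iff)
qed

text \<open>S is an average of the entries with the entries as weights, so S and every nonzero entry
  x lie in the same interval, of length (\<kappa> - 1) m. As m \<le> S, the error x |x - S| / S is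
  at most (\<kappa> - 1) x, and these bounds sum to \<kappa> - 1.\<close>

lemma square_weights_bounds:
  fixes xs :: "real list"
  assumes x: "\<And>x. x \<in> set xs \<Longrightarrow> x = 0 \<or> m \<le> x \<and> x \<le> \<kappa> * m"
    and m: "0 < m" and sum: "sum_list xs = 1"
  defines "S \<equiv> \<Sum>x\<leftarrow>xs. x\<^sup>2" and "r \<equiv> length (filter (\<lambda>x. x \<noteq> 0) xs)"
  shows "m \<le> S" "S \<le> \<kappa> * m" "real r * m \<le> 1" "1 \<le> real r * (\<kappa> * m)"
    "(\<Sum>x\<leftarrow>xs. \<bar>1 / S * x\<^sup>2 - x\<bar>) \<le> \<kappa> - 1"
proof -
  have x0: "0 \<le> x" if "x \<in> set xs" for x using x[OF that] m by auto
  have scale: "(\<Sum>x\<leftarrow>xs. c * x) = c" for c using sum by (simp add: sum_list_const_mult)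
  have sq: "m * x \<le> x\<^sup>2" "x\<^sup>2 \<le> \<kappa> * m * x" if "x \<in> set xs" for x
    using x[OF that] x0[OF that] unfolding power2_eq_square by (auto intro: mult_right_mono)
  have "(\<Sum>x\<leftarrow>xs. m * x) \<le> S" unfolding S_def
    using sq by (intro sum_list_mono)
  then show mS: "m \<le> S" by (simp add: scale sum)
  have "S \<le> (\<Sum>x\<leftarrow>xs. \<kappa> * m * x)" unfolding S_def
    using sq by (intro sum_list_mono)
  then show SM: "S \<le> \<kappa> * m" by (simp add: scale sum)
  \<comment> \<open>Written as a sum over all entries, the count can be compared termwise with the
    sum of the entries, which is 1.\<close>
  have count: "real r * c = (\<Sum>x\<leftarrow>xs. if x = 0 then 0 else c)" for c
    unfolding r_def by (induction xs) (auto simp: algebra_simps)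
  have "real r * m \<le> (\<Sum>x\<leftarrow>xs. x)" unfolding count
    using x by (intro sum_list_mono) auto
  then show "real r * m \<le> 1" using sum by simp
  have "(\<Sum>x\<leftarrow>xs. x) \<le> real r * (\<kappa> * m)" unfolding count
    using x by (intro sum_list_mono) auto
  then show "1 \<le> real r * (\<kappa> * m)" using sum by simp
  have "(\<Sum>x\<leftarrow>xs. \<bar>1 / S * x\<^sup>2 - x\<bar>) \<le> (\<Sum>x\<leftarrow>xs. (\<kappa> - 1) * x)"
  proof (rule sum_list_mono)
    fix y assume y: "y \<in> set xs"
    have S: "0 < S" using m mS by simp
    show "\<bar>1 / S * y\<^sup>2 - y\<bar> \<le> (\<kappa> - 1) * y"
    proof (cases "y = 0")
      case False
      then have "\<bar>y - S\<bar> \<le> (\<kappa> - 1) * m" using x[OF y] mS SM by (auto simp: abs_le_iff algebra_simps)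
      \<comment> \<open>The factor \<kappa> - 1 is nonnegative because m \<le> S \<le> \<kappa> m
        with m positive.\<close>
      also have "\<dots> \<le> (\<kappa> - 1) * S"
        using mS SM m by (intro mult_left_mono) (auto dest: order_trans simp: mult_le_cancel_right1)
      finally have "y * \<bar>y - S\<bar> \<le> y * ((\<kappa> - 1) * S)" using x0[OF y] by (rule mult_left_mono)
      moreover have "\<bar>1 / S * y\<^sup>2 - y\<bar> = y * \<bar>y - S\<bar> / S"
      proof -
        have "1 / S * y\<^sup>2 - y = y * (y - S) / S"
          using S by (simp add: field_simps power2_eq_square)
        then show ?thesis using S x0[OF y] by (simp add: abs_mult)
      qed
      ultimately show ?thesis using S by (simp add: field_simps)
    qed simp
  qed
  then show "(\<Sum>x\<leftarrow>xs. \<bar>1 / S * x\<^sup>2 - x\<bar>) \<le> \<kappa> - 1" by (simp add: scale sum)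
qed

text \<open>Eliminates \<open>lambda_min\<close> through \<open>lambda_max\<close> = \<kappa>
  \<open>lambda_min\<close>. What remains ties S and \<open>lambda_max\<close> to 1 / r up to
  factors of \<kappa>, which is all that the choice of the number of rounds and the query bound
  require.\<close>

lemma density_mat_spectral_bounds:
  assumes dens: "density_mat d \<rho>" and \<kappa>: "lambda_max \<rho> / lambda_min \<rho> = \<kappa>"
  defines "S \<equiv> Re (mat_trace (\<rho> * \<rho>))" and "r \<equiv> vec_space.rank d \<rho>"
  shows "mat_trace (\<rho> * \<rho>) = complex_of_real S" "0 < lambda_max \<rho>"
    "lambda_max \<rho> \<le> \<kappa> * S" "S \<le> lambda_max \<rho>"
    "real r * lambda_max \<rho> \<le> \<kappa>" "1 \<le> real r * lambda_max \<rho>"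
    "trace_norm (complex_of_real (1 / S) \<cdot>\<^sub>m (\<rho> * \<rho>) - \<rho>) \<le> \<kappa> - 1"
proof -
  have psd: "psd_mat d \<rho>" and tr: "mat_trace \<rho> = 1" using dens by (auto simp: density_mat_def)
  have \<rho>: "\<rho> \<in> carrier_mat d d" and herm: "mat_adjoint \<rho> = \<rho>"
    using psd by (auto simp: psd_mat_def)
  obtain es where es: "mset es = proots (char_poly \<rho>)" using ex_mset[of "proots (char_poly \<rho>)"] by blast
  have set_es: "set es = spectrum \<rho>"
  proof -
    have "set es = set_mset (proots (char_poly \<rho>))" by (metis es set_mset_mset)
    then show ?thesis
      using char_poly_nonzero[OF \<rho>] spectrum_root_char_poly[OF \<rho>] by simp
  qed
  have nonneg: "0 \<le> e" if "e \<in> set es" for e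
    using that psd_mat_eigenvalue_nonneg[OF psd] by (auto simp: set_es spectrum_def)
  then have real: "e = complex_of_real (Re e)" if "e \<in> set es" for e
    using that by (auto simp: less_eq_complex_def complex_eq_iff)
  define xs where "xs = map Re es"
  have es_xs: "es = map complex_of_real xs"
    using real by (auto simp: xs_def intro!: nth_equalityI)
  have of_real_sum: "complex_of_real (\<Sum>x\<leftarrow>ys. f x) = (\<Sum>x\<leftarrow>ys. complex_of_real (f x))"
    for f :: "real \<Rightarrow> real" and ys by (induction ys) auto
  have "mat_trace \<rho> = (\<Sum>e\<leftarrow>es. e)"
    unfolding mat_trace_eq_sum_proots(1)[OF \<rho>] es[symmetric] by (simp add: sum_mset_sum_list)
  also have "\<dots> = complex_of_real (\<Sum>x\<leftarrow>xs. x)"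
    unfolding of_real_sum by (subst es_xs) (simp add: comp_def)
  finally have sum: "sum_list xs = 1" using tr by simp
  have "mat_trace (\<rho> * \<rho>) = (\<Sum>e\<leftarrow>es. e\<^sup>2)"
    unfolding mat_trace_eq_sum_proots(2)[OF \<rho>] es[symmetric] mset_map[symmetric] sum_mset_sum_list ..
  also have "\<dots> = complex_of_real (\<Sum>x\<leftarrow>xs. x\<^sup>2)"
    unfolding of_real_sum by (subst es_xs) (simp add: comp_def)
  finally have "mat_trace (\<rho> * \<rho>) = complex_of_real (\<Sum>x\<leftarrow>xs. x\<^sup>2)" .
  then have S: "S = (\<Sum>x\<leftarrow>xs. x\<^sup>2)" and trS: "mat_trace (\<rho> * \<rho>) = complex_of_real S"
    by (simp_all add: S_def)
  define M where "M = lambda_max \<rho>"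
  define m where "m = lambda_min \<rho>"
  have M: "M = Max (set xs)" and m: "m = Min (set xs - {0})"
  proof -
    have spec: "spectrum \<rho> = complex_of_real ` set xs" unfolding set_es[symmetric]
      by (subst es_xs) simp
    have "Re ` spectrum \<rho> = set xs" by (simp add: spec image_image)
    moreover have "Re ` (spectrum \<rho> - {0}) = set xs - {0}"
      unfolding spec by (force simp: image_iff)
    ultimately show "M = Max (set xs)" "m = Min (set xs - {0})"
      by (simp_all add: M_def m_def lambda_max_def lambda_min_def)
  qed
  have x0: "0 \<le> x" if "x \<in> set xs" for x
    using that nonneg by (auto simp: xs_def less_eq_complex_def)
  \<comment> \<open>Guards against \<open>Min\<close> of an empty set: trace 1 forces a nonzero
    eigenvalue. Hence \<open>lambda_min\<close> is a genuine positive eigenvalue and the quotient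
    defining \<kappa> is not a division by 0.\<close>
  have "\<not> set xs \<subseteq> {0}"
  proof
    assume "set xs \<subseteq> {0}"
    then have "sum_list xs = 0" by (induction xs) auto
    then show False using sum by simp
  qed
  then have "m \<in> set xs - {0}" unfolding m by (intro Min_in) auto
  then have m_pos: "0 < m" using x0 by force
  then have M_eq: "M = \<kappa> * m" using \<kappa> by (simp add: M_def m_def field_simps)
  have x: "x = 0 \<or> m \<le> x \<and> x \<le> \<kappa> * m" if "x \<in> set xs" for x
  proof -
    have "x \<le> M" unfolding M using that by simp
    moreover have "m \<le> x" if "x \<noteq> 0" unfolding m using that \<open>x \<in> set xs\<close> by simp
    ultimately show ?thesis unfolding M_eq by blast
  qed
  have r: "r = length (filter (\<lambda>x. x \<noteq> 0) xs)"
  proof -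
    have "r = length (filter (\<lambda>e. e \<noteq> 0) es)"
      unfolding r_def hermitian_rank_eq_size[OF \<rho> herm] es[symmetric] mset_filter[symmetric] size_mset ..
    also have "\<dots> = length (filter (\<lambda>x. x \<noteq> 0) xs)"
      by (subst es_xs) (simp add: filter_map comp_def)
    finally show ?thesis .
  qed
  note bounds = square_weights_bounds[OF x m_pos sum, folded S r, folded M_eq]
  have \<kappa>1: "0 < \<kappa>" "0 < M"     using less_le_trans[OF m_pos order_trans[OF bounds(1,2)]] m_pos M_eq
    by (auto simp: zero_less_mult_iff)
  show "mat_trace (\<rho> * \<rho>) = complex_of_real S" by (fact trS)
  show "0 < lambda_max \<rho>" using \<kappa>1 by (simp add: M_def)
  show "S \<le> lambda_max \<rho>" "1 \<le> real r * lambda_max \<rho>" using bounds by (simp_all add: M_def)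
  show "lambda_max \<rho> \<le> \<kappa> * S" using bounds(1) \<kappa>1 M_eq by (simp add: flip: M_def)
  show "real r * lambda_max \<rho> \<le> \<kappa>"
    using mult_left_mono[OF bounds(3), of \<kappa>] \<kappa>1 M_eq by (simp add: mult_ac flip: M_def)
  have "trace_norm (complex_of_real (1 / S) \<cdot>\<^sub>m (\<rho> * \<rho>) - \<rho>) =
      (\<Sum>x\<leftarrow>xs. sqrt (Re ((complex_of_real (1 / S * x\<^sup>2 - x))\<^sup>2)))"
    unfolding trace_norm_hermitian_quadratic[OF \<rho> herm] es[symmetric] es_xs
    by (simp add: comp_def sum_mset_sum_list flip: mset_map)
  also have "\<dots> = (\<Sum>x\<leftarrow>xs. \<bar>1 / S * x\<^sup>2 - x\<bar>)"
    by (simp only: of_real_power[symmetric] Re_complex_of_real real_sqrt_abs)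
  finally show "trace_norm (complex_of_real (1 / S) \<cdot>\<^sub>m (\<rho> * \<rho>) - \<rho>) \<le> \<kappa> - 1"
    using bounds(5) by simp
qed

section \<open>Tensor products and pure states\<close>

text \<open>Splits a sum over a tensor product basis. Quotient and remainder are separate arguments
  of \<open>f\<close>, which is the shape that \<open>kron_index\<close> produces.\<close>

lemma sum_div_mod:
  fixes f :: "nat \<Rightarrow> nat \<Rightarrow> 'a :: comm_monoid_add"
  shows "(\<Sum>k<m * n. f (k div n) (k mod n)) = (\<Sum>i<m. \<Sum>j<n. f i j)"
proof -
  have "(\<Sum>k<m * n. f (k div n) (k mod n)) = (\<Sum>i<m. \<Sum>k\<in>{i * n..<i * n + n}. f (k div n) (k mod n))"
    by (rule sum.nat_group[symmetric])
  also have "\<dots> = (\<Sum>i<m. \<Sum>j<n. f i j)"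
  proof (rule sum.cong[OF refl])
    fix i
    have "(\<Sum>k\<in>{i * n..<i * n + n}. f (k div n) (k mod n)) =
        (\<Sum>j\<in>{0..<n}. f ((j + i * n) div n) ((j + i * n) mod n))"
      using sum.shift_bounds_nat_ivl[of "\<lambda>k. f (k div n) (k mod n)" 0 "i * n" n]
      by (simp add: add.commute)
    also have "\<dots> = (\<Sum>j<n. f i j)"
      by (intro sum.cong) (auto simp: atLeast0LessThan)
    finally show "(\<Sum>k\<in>{i * n..<i * n + n}. f (k div n) (k mod n)) = (\<Sum>j<n. f i j)" .
  qed
  finally show ?thesis .
qed

lemma kron_carrier:
  "A \<in> carrier_mat m n \<Longrightarrow> B \<in> carrier_mat p q \<Longrightarrow> kron A B \<in> carrier_mat (m * p) (n * q)"
  by (auto simp: kron_def)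

lemma kron_index:
  assumes "A \<in> carrier_mat m n" "B \<in> carrier_mat p q" "i < m * p" "j < n * q"
  shows "kron A B $$ (i, j) = A $$ (i div p, j div q) * B $$ (i mod p, j mod q)"
  using assms by (simp add: kron_def)

lemma kron_mult:
  assumes A: "A \<in> carrier_mat m n" and B: "B \<in> carrier_mat p q"
    and C: "C \<in> carrier_mat n k" and D: "D \<in> carrier_mat q l"
  shows "kron A B * kron C D = kron (A * C) (B * D)"
proof (rule eq_matI)
  note AB = kron_carrier[OF A B] and CD = kron_carrier[OF C D]
  note R = kron_carrier[OF mult_carrier_mat[OF A C] mult_carrier_mat[OF B D]]
  show "dim_row (kron A B * kron C D) = dim_row (kron (A * C) (B * D))"
    "dim_col (kron A B * kron C D) = dim_col (kron (A * C) (B * D))"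
    using AB CD R by auto
  fix i j assume "i < dim_row (kron (A * C) (B * D))" "j < dim_col (kron (A * C) (B * D))"
  then have i: "i < m * p" and j: "j < k * l" using R by auto
  have bounds: "i div p < m" "i mod p < p" "j div l < k" "j mod l < l"
    using i j by (auto simp: less_mult_imp_div_less intro!: mod_less_divisor gr0I)
  have "(kron A B * kron C D) $$ (i, j) = (\<Sum>t<n * q. kron A B $$ (i, t) * kron C D $$ (t, j))"
    using i j AB CD by (simp add: scalar_prod_def atLeast0LessThan)
  also have "\<dots> = (\<Sum>t<n * q. (A $$ (i div p, t div q) * B $$ (i mod p, t mod q)) *
      (C $$ (t div q, j div l) * D $$ (t mod q, j mod l)))"
    using i j by (intro sum.cong) (simp_all add: kron_index[OF A B] kron_index[OF C D])
  also have "\<dots> = (\<Sum>x<n. \<Sum>y<q. (A $$ (i div p, x) * B $$ (i mod p, y)) *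
      (C $$ (x, j div l) * D $$ (y, j mod l)))"
    by (rule sum_div_mod)
  also have "\<dots> = (\<Sum>x<n. A $$ (i div p, x) * C $$ (x, j div l)) *
      (\<Sum>y<q. B $$ (i mod p, y) * D $$ (y, j mod l))"
    by (simp add: sum_product mult_ac)
  also have "\<dots> = (A * C) $$ (i div p, j div l) * (B * D) $$ (i mod p, j mod l)"
    using bounds A B C D by (simp add: scalar_prod_def atLeast0LessThan)
  also have "\<dots> = kron (A * C) (B * D) $$ (i, j)"
    using i j by (subst kron_index[OF mult_carrier_mat[OF A C] mult_carrier_mat[OF B D]]) auto
  finally show "(kron A B * kron C D) $$ (i, j) = kron (A * C) (B * D) $$ (i, j)" .
qed

lemma kron_mat_diag_one:
  "kron (mat_diag m f) (1\<^sub>m n) = mat_diag (m * n) (\<lambda>i. f (i div n))"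
proof (rule eq_matI)
  fix i j assume "i < dim_row (mat_diag (m * n) (\<lambda>i. f (i div n)))"
    "j < dim_col (mat_diag (m * n) (\<lambda>i. f (i div n)))"
  then have i: "i < m * n" and j: "j < m * n" by (auto simp: mat_diag_def)
  have bounds: "i div n < m" "i mod n < n" "j div n < m" "j mod n < n"
    using i j by (auto simp: less_mult_imp_div_less intro!: mod_less_divisor gr0I)
  have "i = j \<longleftrightarrow> i div n = j div n \<and> i mod n = j mod n"
    by (metis div_mult_mod_eq)
  then show "kron (mat_diag m f) (1\<^sub>m n) $$ (i, j) = mat_diag (m * n) (\<lambda>i. f (i div n)) $$ (i, j)"
    using i j bounds
    by (subst kron_index[of _ m m _ n n]) (auto simp: mat_diag_def)
qed (auto simp: kron_def mat_diag_def)

lemma kron_one_one: "kron (1\<^sub>m m) (1\<^sub>m n) = 1\<^sub>m (m * n)"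
  using kron_mat_diag_one[of m "\<lambda>_. 1" n] by (simp add: mat_diag_one)

lemma mat_adjoint_kron:
  "mat_adjoint (kron A B) = kron (mat_adjoint A) (mat_adjoint B)"
proof (rule eq_matI)
  fix i j
  assume "i < dim_row (kron (mat_adjoint A) (mat_adjoint B))"
    "j < dim_col (kron (mat_adjoint A) (mat_adjoint B))"
  then have i: "i < dim_col A * dim_col B" and j: "j < dim_row A * dim_row B"
    by (auto simp: kron_def mat_adjoint_eq)
  have "i div dim_col B < dim_col A" "i mod dim_col B < dim_col B"
    "j div dim_row B < dim_row A" "j mod dim_row B < dim_row B"
    using i j by (auto simp: less_mult_imp_div_less intro!: mod_less_divisor gr0I)
  then show "mat_adjoint (kron A B) $$ (i, j) = kron (mat_adjoint A) (mat_adjoint B) $$ (i, j)"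
    using i j by (simp add: kron_def mat_adjoint_eq)
qed (auto simp: kron_def mat_adjoint_eq)

lemma mat_adjoint_one: "mat_adjoint (1\<^sub>m n) = (1\<^sub>m n :: complex mat)"
  by (intro eq_matI) (auto simp: mat_adjoint_eq)

lemma unitary_mat_kron_one:
  assumes "unitary_mat n U"
  shows "unitary_mat (m * n) (kron (1\<^sub>m m) U)"
proof -
  have U: "U \<in> carrier_mat n n" "mat_adjoint U \<in> carrier_mat n n"
    using assms by (auto simp: unitary_mat_def mat_adjoint_carrier)
  show ?thesis
    using assms U
    by (simp add: unitary_mat_def mat_adjoint_kron mat_adjoint_one kron_carrier kron_one_one
        kron_mult[of _ m m _ n n _ m _ n])
qed

text \<open>Through this the success probability is the trace of the unnormalised output state, so
  one computation serves both.\<close>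

lemma mat_trace_ptrace_fst:
  assumes "A \<in> carrier_mat (n * d) (n * d)"
  shows "mat_trace (ptrace_fst n d A) = mat_trace A"
proof -
  have "mat_trace (ptrace_fst n d A) = (\<Sum>i<d. \<Sum>k<n. A $$ (k * d + i, k * d + i))"
    by (simp add: mat_trace_def ptrace_fst_def)
  also have "\<dots> = (\<Sum>k<n. \<Sum>i<d. A $$ (k * d + i, k * d + i))" by (rule sum.swap)
  also have "\<dots> = (\<Sum>t<n * d. A $$ (t div d * d + t mod d, t div d * d + t mod d))"
    by (rule sum_div_mod[symmetric])
  also have "\<dots> = mat_trace A" using assms by (simp add: mat_trace_def)
  finally show ?thesis .
qed

section \<open>Pure states as rank one matrices\<close>

definition outer :: "complex vec \<Rightarrow> complex mat" where
  "outer v = mat (dim_vec v) (dim_vec v) (\<lambda>(i, j). v $ i * conjugate (v $ j))"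

lemma outer_carrier: "v \<in> carrier_vec n \<Longrightarrow> outer v \<in> carrier_mat n n"
  by (auto simp: outer_def)

lemma outer_mult_vec:
  assumes "v \<in> carrier_vec n" "x \<in> carrier_vec n"
  shows "outer v *\<^sub>v x = (x \<bullet>c v) \<cdot>\<^sub>v v"
  using assms
  by (intro eq_vecI) (auto simp: outer_def scalar_prod_def sum_distrib_left sum_distrib_right mult_ac
      intro!: sum.cong)

lemma mat_adjoint_outer: "mat_adjoint (outer v) = outer v"
  by (intro eq_matI) (auto simp: mat_adjoint_eq outer_def conjugate_dist_mul mult.commute)

lemma mat_trace_outer: "mat_trace (outer v) = v \<bullet>c v"
  by (simp add: mat_trace_def outer_def scalar_prod_def atLeast0LessThan)

lemma density_mat_outer:
  assumes v: "v \<in> carrier_vec n" and "v \<bullet>c v = 1"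
  shows "density_mat n (outer v)"
proof -
  have "0 \<le> (outer v *\<^sub>v x) \<bullet>c x" if x: "x \<in> carrier_vec n" for x
  proof -
    have "(outer v *\<^sub>v x) \<bullet>c x = (x \<bullet>c v) * (v \<bullet>c x)"
      using v x by (simp add: outer_mult_vec)
    also have "v \<bullet>c x = conjugate (x \<bullet>c v)"
      using v x by (simp add: scalar_prod_def sum_conjugate conjugate_dist_mul mult.commute)
    finally show ?thesis by (simp add: less_eq_complex_def complex_mult_cnj)
  qed
  then show ?thesis
    using assms by (simp add: density_mat_def psd_mat_def outer_carrier mat_adjoint_outer mat_trace_outer)
qed

text \<open>The initial state is pure and every step is a unitary channel, so the whole run can be
  followed on vectors.\<close>

lemma conj_channel_outer:
  assumes V: "V \<in> carrier_mat n n" and v: "v \<in> carrier_vec n"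
  shows "conj_channel V (outer v) = outer (V *\<^sub>v v)"
proof (rule eq_matI)
  have VO: "V * outer v = mat n n (\<lambda>(i, k). (V *\<^sub>v v) $ i * conjugate (v $ k))"
    using V v by (intro eq_matI) (auto simp: outer_def scalar_prod_def sum_distrib_left mult_ac)
  fix i j assume "i < dim_row (outer (V *\<^sub>v v))" "j < dim_col (outer (V *\<^sub>v v))"
  then have ij: "i < n" "j < n" using V by (auto simp: outer_def)
  have "conj_channel V (outer v) $$ (i, j) =
      (\<Sum>k<n. (V *\<^sub>v v) $ i * conjugate (v $ k) * conjugate (V $$ (j, k)))"
    unfolding conj_channel_def VO using ij V
    by (simp add: scalar_prod_def mat_adjoint_eq atLeast0LessThan)
  also have "\<dots> = (V *\<^sub>v v) $ i * conjugate ((V *\<^sub>v v) $ j)"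
    using ij V v
    by (simp add: scalar_prod_def sum_conjugate conjugate_dist_mul sum_distrib_left atLeast0LessThan mult_ac)
  finally show "conj_channel V (outer v) $$ (i, j) = outer (V *\<^sub>v v) $$ (i, j)"
    using ij V by (simp add: outer_def)
qed (use assms in \<open>auto simp: conj_channel_def outer_def mat_adjoint_eq\<close>)

section \<open>Amplitude amplification\<close>

lemma scalar_prod_unitary:
  assumes W: "unitary_mat n W" and x: "x \<in> carrier_vec n" and y: "y \<in> carrier_vec n"
  shows "(W *\<^sub>v x) \<bullet>c (W *\<^sub>v y) = x \<bullet>c y"
proof -
  have Wc: "W \<in> carrier_mat n n" and WW: "mat_adjoint W * W = 1\<^sub>m n"
    using W by (auto simp: unitary_mat_def)
  have "(W *\<^sub>v x) \<bullet>c (W *\<^sub>v y) = x \<bullet>c (mat_adjoint W *\<^sub>v (W *\<^sub>v y))"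
    using Wc x y by (intro adjoint_scalar_prod) auto
  also have "mat_adjoint W *\<^sub>v (W *\<^sub>v y) = y"
    using assoc_mult_mat_vec[OF mat_adjoint_carrier[OF Wc] Wc y] WW y by simp
  finally show ?thesis .
qed

text \<open>The Grover oracle: \<open>P\<close> marks the basis indices of the good
  subspace.\<close>

definition phase_flip :: "nat \<Rightarrow> (nat \<Rightarrow> bool) \<Rightarrow> complex mat" where
  "phase_flip n P = mat_diag n (\<lambda>i. if P i then - 1 else 1)"

text \<open>For a unit vector \<open>v\<close> this fixes \<open>v\<close> and negates its
  orthogonal complement.\<close>

definition reflection :: "complex vec \<Rightarrow> complex mat" where
  "reflection v = 2 \<cdot>\<^sub>m outer v - 1\<^sub>m (dim_vec v)"

lemma mat_adjoint_mat_diag: "mat_adjoint (mat_diag n f) = mat_diag n (\<lambda>i. cnj (f i))"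
  by (intro eq_matI) (auto simp: mat_adjoint_eq mat_diag_def)

lemma unitary_mat_phase_flip: "unitary_mat n (phase_flip n P)"
proof -
  have "mat_adjoint (phase_flip n P) = phase_flip n P"
    unfolding phase_flip_def mat_adjoint_mat_diag by (rule arg_cong[of _ _ "mat_diag n"]) auto
  moreover have "phase_flip n P * phase_flip n P = mat_diag n (\<lambda>_. 1)"
    unfolding phase_flip_def mat_diag_diag by (rule arg_cong[of _ _ "mat_diag n"]) auto
  ultimately show ?thesis by (simp add: unitary_mat_def) (simp add: phase_flip_def)
qed

lemma reflection_carrier: "v \<in> carrier_vec n \<Longrightarrow> reflection v \<in> carrier_mat n n"
  by (auto simp: reflection_def intro!: minus_carrier_mat)

lemma reflection_mult_vec:
  assumes "v \<in> carrier_vec n" "x \<in> carrier_vec n"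
  shows "reflection v *\<^sub>v x = (2 * (x \<bullet>c v)) \<cdot>\<^sub>v v - x"
proof -
  have "reflection v *\<^sub>v x = (2 \<cdot>\<^sub>m outer v) *\<^sub>v x - 1\<^sub>m n *\<^sub>v x"
    unfolding reflection_def using assms
    by (simp add: minus_mult_distrib_mat_vec[of _ n n] outer_carrier)
  also have "(2 \<cdot>\<^sub>m outer v) *\<^sub>v x = 2 \<cdot>\<^sub>v (outer v *\<^sub>v x)"
    using assms outer_carrier[OF assms(1)]
    by (intro eq_vecI) (auto simp: scalar_prod_def sum_distrib_left mult.assoc)
  finally show ?thesis using assms by (simp add: outer_mult_vec[of v n] smult_smult_assoc)
qed

lemma unitary_mat_reflection:
  assumes v: "v \<in> carrier_vec n" and norm: "v \<bullet>c v = 1"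
  shows "unitary_mat n (reflection v)"
proof -
  have O: "outer v \<in> carrier_mat n n" by (rule outer_carrier[OF v])
  have R: "reflection v \<in> carrier_mat n n" by (rule reflection_carrier[OF v])
  have adj: "mat_adjoint (reflection v) = reflection v"
    unfolding reflection_def using O v
    by (simp add: mat_adjoint_minus[of _ n n] mat_adjoint_smult mat_adjoint_outer mat_adjoint_one)
  have "reflection v * reflection v = 1\<^sub>m n"
  proof (rule mat_col_eqI)
    fix i assume "i < dim_col (1\<^sub>m n :: complex mat)"
    then have i: "i < n" by simp
    define x :: "complex vec" where "x = unit_vec n i"
    have x: "x \<in> carrier_vec n" by (simp add: x_def)
    have "col (reflection v * reflection v) i = reflection v *\<^sub>v (reflection v *\<^sub>v x)"
      using col_mult2[OF R R i] col_mult2[OF R one_carrier_mat i] i R by (simp add: x_def)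
    also have "\<dots> = x"
    proof -
      let ?c = "2 * (x \<bullet>c v)"
      have "(?c \<cdot>\<^sub>v v - x) \<bullet>c v = x \<bullet>c v"
        using v x norm by (simp add: minus_scalar_prod_distrib[of _ n])
      then show ?thesis
        using v x by (simp add: reflection_mult_vec) (intro eq_vecI, auto)
    qed
    finally show "col (reflection v * reflection v) i = col (1\<^sub>m n) i"
      using i by (simp add: x_def)
  qed (use R in auto)
  then show ?thesis using R adj by (simp add: unitary_mat_def)
qed

text \<open>In \<open>w x y\<close> the good part of v is scaled by x and the bad part by y. The
  flip turns x into -x, and conjugating the reflection about \<psi> by W gives the reflection about
  v. The result is 2 c v - \<open>w (- x) y\<close>, where c is the inner product of
  \<open>w (- x) y\<close> with v, namely y (1 - s) - x s for the weight s of the good part.\<close>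

lemma amplification_step:
  fixes W :: "complex mat" and P :: "nat \<Rightarrow> bool" and s x y :: real
  assumes W: "unitary_mat n W" and \<psi>: "\<psi> \<in> carrier_vec n" and norm: "\<psi> \<bullet>c \<psi> = 1"
  defines "v \<equiv> W *\<^sub>v \<psi>"
  defines "w \<equiv> \<lambda>x y. vec n (\<lambda>i. complex_of_real (if P i then x else y) * v $ i)"
  assumes s: "(\<Sum>i | i < n \<and> P i. (cmod (v $ i))\<^sup>2) = s"
  defines "c \<equiv> y * (1 - s) - x * s"
  shows "W *\<^sub>v (reflection \<psi> *\<^sub>v (mat_adjoint W *\<^sub>v (phase_flip n P *\<^sub>v w x y))) =
    w (2 * c + x) (2 * c - y)"
proof -
  have Wc: "W \<in> carrier_mat n n" "mat_adjoint W \<in> carrier_mat n n"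
    and WW: "W * mat_adjoint W = 1\<^sub>m n"
    using W by (auto simp: unitary_mat_def mat_adjoint_carrier)
  have v: "v \<in> carrier_vec n" using Wc \<psi> by (simp add: v_def)
  have w: "w x y \<in> carrier_vec n" for x y by (simp add: w_def)
  have flip: "phase_flip n P *\<^sub>v w x y = w (- x) y"
  proof (rule eq_vecI)
    fix i assume "i < dim_vec (w (- x) y)"
    then have i: "i < n" by (simp add: w_def)
    have "(phase_flip n P *\<^sub>v w x y) $ i =
        (\<Sum>j<n. (if i = j then if P j then - 1 else 1 else 0) * w x y $ j)"
      using i w[of x y] by (simp add: phase_flip_def mat_diag_def scalar_prod_def atLeast0LessThan)
    also have "\<dots> = (\<Sum>j\<in>{i}. (if i = j then if P j then - 1 else 1 else 0) * w x y $ j)"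
      using i by (intro sum.mono_neutral_right) auto
    also have "\<dots> = w (- x) y $ i" using i by (simp add: w_def)
    finally show "(phase_flip n P *\<^sub>v w x y) $ i = w (- x) y $ i" .
  qed (simp add: w_def phase_flip_def mat_diag_def)
  define u where "u = mat_adjoint W *\<^sub>v w (- x) y"
  have u: "u \<in> carrier_vec n" using Wc w by (simp add: u_def)
  have Wu: "W *\<^sub>v u = w (- x) y"
    using Wc w[of "- x" y] WW by (simp add: u_def flip: assoc_mult_mat_vec)
  have total: "(\<Sum>i<n. (cmod (v $ i))\<^sup>2) = 1"
  proof -
    have "complex_of_real (\<Sum>i<n. (cmod (v $ i))\<^sup>2) = v \<bullet>c v"
      using v by (simp add: scalar_prod_def atLeast0LessThan complex_norm_square del: of_real_power)
    also have "\<dots> = 1" using scalar_prod_unitary[OF W \<psi> \<psi>] norm by (simp add: v_def)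
    finally show ?thesis using of_real_eq_1_iff by blast
  qed
  have split: "(\<Sum>i<n. (if P i then a else b) * (cmod (v $ i))\<^sup>2) = a * s + b * (1 - s)" for a b
  proof -
    have "(\<Sum>i<n. if P i then (cmod (v $ i))\<^sup>2 else 0) = s"
      unfolding s[symmetric] by (intro sum.mono_neutral_cong_right) auto
    moreover have "(\<Sum>i<n. (if P i then a else b) * (cmod (v $ i))\<^sup>2) =
        (\<Sum>i<n. (a - b) * (if P i then (cmod (v $ i))\<^sup>2 else 0) + b * (cmod (v $ i))\<^sup>2)"
      by (intro sum.cong) (auto simp: algebra_simps)
    ultimately have "(\<Sum>i<n. (if P i then a else b) * (cmod (v $ i))\<^sup>2) = (a - b) * s + b * 1"
      by (simp only: sum.distrib sum_distrib_left[symmetric] total)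
    then show ?thesis by (simp add: algebra_simps)
  qed
  \<comment> \<open>Applying the unitary W to both arguments replaces \<psi> by v; the inner product
    then depends on v only through s.\<close>
  have "u \<bullet>c \<psi> = w (- x) y \<bullet>c v"
    using scalar_prod_unitary[OF W u \<psi>] by (simp add: Wu v_def)
  also have "\<dots> = complex_of_real (\<Sum>i<n. (if P i then - x else y) * (cmod (v $ i))\<^sup>2)"
    using v unfolding w_def
    by (simp add: scalar_prod_def atLeast0LessThan complex_norm_square mult.assoc del: of_real_power)
  also have "\<dots> = complex_of_real c" unfolding split by (simp add: c_def)
  finally have inner: "u \<bullet>c \<psi> = complex_of_real c" .
  have "W *\<^sub>v (reflection \<psi> *\<^sub>v u) = W *\<^sub>v ((2 * complex_of_real c) \<cdot>\<^sub>v \<psi> - u)"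
    using reflection_mult_vec[OF \<psi> u] inner by simp
  also have "\<dots> = (2 * complex_of_real c) \<cdot>\<^sub>v v - w (- x) y"
    using Wc \<psi> u Wu by (simp add: mult_minus_distrib_mat_vec[of _ n n] mult_mat_vec[of _ n n] v_def)
  also have "\<dots> = w (2 * c + x) (2 * c - y)"
    using v by (intro eq_vecI) (auto simp: w_def algebra_simps)
  finally show ?thesis by (simp add: flip u_def)
qed

text \<open>The amplitudes \<open>x\<close> and \<open>y\<close> are characterised without division because \<open>cos \<theta>\<close> may vanish.\<close>

lemma amplification_iterate:
  fixes W :: "complex mat" and P :: "nat \<Rightarrow> bool" and \<theta> :: real
  assumes W: "unitary_mat n W" and \<psi>: "\<psi> \<in> carrier_vec n" and norm: "\<psi> \<bullet>c \<psi> = 1"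
  defines "v \<equiv> W *\<^sub>v \<psi>"
  defines "w \<equiv> \<lambda>x y. vec n (\<lambda>i. complex_of_real (if P i then x else y) * v $ i)"
  assumes s: "(\<Sum>i | i < n \<and> P i. (cmod (v $ i))\<^sup>2) = (sin \<theta>)\<^sup>2"
  defines "G \<equiv> \<lambda>z. W *\<^sub>v (reflection \<psi> *\<^sub>v (mat_adjoint W *\<^sub>v (phase_flip n P *\<^sub>v z)))"
  shows "\<exists>x y. (G ^^ k) v = w x y \<and> x * sin \<theta> = sin ((2 * real k + 1) * \<theta>) \<and>
    y * cos \<theta> = cos ((2 * real k + 1) * \<theta>)"
proof (induction k)
  case 0
  have "v \<in> carrier_vec n" using W \<psi> by (auto simp: v_def unitary_mat_def)
  then have "v = w 1 1" unfolding w_def by (intro eq_vecI) auto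
  then show ?case by (intro exI[of _ 1]) simp
next
  case (Suc k)
  then obtain x y where G: "(G ^^ k) v = w x y"
    and x: "x * sin \<theta> = sin ((2 * real k + 1) * \<theta>)"
    and y: "y * cos \<theta> = cos ((2 * real k + 1) * \<theta>)" by blast
  define c where "c = y * (1 - (sin \<theta>)\<^sup>2) - x * (sin \<theta>)\<^sup>2"
  define t where "t = (2 * real k + 1) * \<theta>"
  have "c = (y * cos \<theta>) * cos \<theta> - (x * sin \<theta>) * sin \<theta>"
    unfolding c_def cos_squared_eq[symmetric] by (simp add: power2_eq_square)
  also have "\<dots> = cos (t + \<theta>)" unfolding x y by (simp add: t_def cos_add)
  finally have c: "c = cos (t + \<theta>)" .
  \<comment> \<open>The old and new angles lie symmetrically about t + \<theta>, whose cosine is c.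
    The recurrence is thus the identity sin (b + \<theta>) - sin (b - \<theta>) = 2 cos b sin
    \<theta> with b = t + \<theta>, and its analogue for the cosine.\<close>
  have t2: "(2 * real (Suc k) + 1) * \<theta> = (t + \<theta>) + \<theta>" and t0: "t = (t + \<theta>) - \<theta>"
    by (simp_all add: t_def algebra_simps)
  have "(G ^^ Suc k) v = G (w x y)" using G by simp
  also have "\<dots> = w (2 * c + x) (2 * c - y)"
    unfolding G_def w_def v_def c_def
    by (rule amplification_step[OF W \<psi> norm]) (use s in \<open>simp add: v_def\<close>)
  finally have "(G ^^ Suc k) v = w (2 * c + x) (2 * c - y)" .
  moreover have "(2 * c + x) * sin \<theta> = sin ((2 * real (Suc k) + 1) * \<theta>)"
    using sin_add[of "t + \<theta>" \<theta>] sin_diff[of "t + \<theta>" \<theta>]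
    unfolding t2 unfolding distrib_right x[folded t_def] c t0[symmetric] by simp
  moreover have "(2 * c - y) * cos \<theta> = cos ((2 * real (Suc k) + 1) * \<theta>)"
    using cos_add[of "t + \<theta>" \<theta>] cos_diff[of "t + \<theta>" \<theta>]
    unfolding t2 unfolding left_diff_distrib y[folded t_def] c t0[symmetric] by simp
  ultimately show ?case by blast
qed

section \<open>Block encodings, the amplification circuit and its run\<close>

lemma block_encoding_index:
  assumes be: "block_encoding d \<alpha> a U \<rho>" and ij: "i < d" "j < d"
  shows "\<rho> $$ (i, j) = complex_of_real \<alpha> * U $$ (i, j)"
proof -
  define n where "n = 2 ^ a * d"
  define K where "K = kron (ket_zero a) (1\<^sub>m d)"
  have dn: "d \<le> n" by (simp add: n_def)
  have K: "K \<in> carrier_mat n d"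
    using kron_carrier[of "ket_zero a" "2 ^ a" 1 "1\<^sub>m d" d d] by (simp add: K_def n_def ket_zero_def)
  have U: "U \<in> carrier_mat n n" using be by (auto simp: block_encoding_def unitary_mat_def n_def)
  \<comment> \<open>The qubits precede the system and are in their first basis state, so K includes
    the system as the first d coordinates. The encoded block is therefore the top left corner of
    U.\<close>
  have K_col: "col K j = unit_vec n j" if "j < d" for j
  proof (rule eq_vecI)
    fix k assume "k < dim_vec (unit_vec n j :: complex vec)"
    then have k: "k < n" by simp
    have "k mod d < d" "k div d < 2 ^ a"
      using k that by (auto simp: n_def less_mult_imp_div_less)
    moreover have "k div d = 0 \<and> k mod d = j \<longleftrightarrow> k = j"
      using that by (metis div_less mod_less div_mult_mod_eq add_0 mult_0)
    ultimately show "col K j $ k = unit_vec n j $ k"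
      using k that K unfolding K_def
      by (auto simp: kron_index[of _ "2 ^ a" 1 _ d d] ket_zero_def n_def unit_vec_def)
  qed (use K in simp)
  have "kron (mat_adjoint (ket_zero a)) (1\<^sub>m d) = mat_adjoint K"
    by (simp add: K_def mat_adjoint_kron mat_adjoint_one)
  then have "\<rho> = complex_of_real \<alpha> \<cdot>\<^sub>m (mat_adjoint K * U * K)"
    using be by (simp add: block_encoding_def K_def)
  moreover have "(mat_adjoint K * U * K) $$ (i, j) = U $$ (i, j)"
  proof -
    have "(mat_adjoint K * U * K) $$ (i, j) = row (mat_adjoint K * U) i \<bullet> col K j"
      using K U ij by (simp add: mat_adjoint_eq)
    also have "\<dots> = (mat_adjoint K * U) $$ (i, j)"
      using K U ij dn by (simp add: K_col scalar_prod_right_unit mat_adjoint_eq)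
    also have "\<dots> = row (mat_adjoint K) i \<bullet> col U j"
      using K U ij dn by (simp add: mat_adjoint_eq)
    also have "row (mat_adjoint K) i = unit_vec n i"
    proof (rule eq_vecI)
      fix k assume k: "k < dim_vec (unit_vec n i :: complex vec)"
      have "row (mat_adjoint K) i $ k = cnj (col K i $ k)"
        using K ij k by (simp add: mat_adjoint_eq)
      also have "\<dots> = unit_vec n i $ k" using k by (simp add: K_col ij unit_vec_def)
      finally show "row (mat_adjoint K) i $ k = unit_vec n i $ k" .
    qed (use K in \<open>simp add: mat_adjoint_eq\<close>)
    also have "unit_vec n i \<bullet> col U j = U $$ (i, j)"
    proof -
      have "col U j \<in> carrier_vec n" using U by auto
      then have "unit_vec n i \<bullet> col U j = col U j $ i" by (rule scalar_prod_left_unit) (use ij dn in simp)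
      then show ?thesis using U ij dn by simp
    qed
    finally show ?thesis .
  qed
  ultimately show ?thesis using K U ij by (simp add: mat_adjoint_eq)
qed

text \<open>The ancilla is a second copy of the system; a basis index of the workspace is
  \<open>(k * 2 ^ a + q) * d + i\<close> with ancilla index \<open>k\<close>, qubit index \<open>q\<close> and system index \<open>i\<close>.\<close>

definition max_entangled :: "nat \<Rightarrow> nat \<Rightarrow> complex vec" where
  "max_entangled d a = vec (d * (2 ^ a * d))
     (\<lambda>i. if i mod (2 ^ a * d) = i div (2 ^ a * d) then complex_of_real (1 / sqrt (real d)) else 0)"

text \<open>Since i div d = k * 2 ^ a + q, divisibility by 2 ^ a says that the qubit index q is 0.
  The last three steps together are the reflection about the state prepared by the first
  query.\<close>

definition amplification_round :: "nat \<Rightarrow> nat \<Rightarrow> alg_step list" where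
  "amplification_round d a =
     [Fixed (phase_flip (d * (2 ^ a * d)) (\<lambda>i. 2 ^ a dvd i div d)), Query_Adjoint,
      Fixed (reflection (max_entangled d a)), Query]"

text \<open>The leading query prepares the state to be amplified. The success effect lives on
  ancilla and qubits only, so its index is tested without the division by d that the phase flip
  needs.\<close>

definition amplification_algorithm :: "nat \<Rightarrow> nat \<Rightarrow> nat \<Rightarrow> query_algorithm" where
  "amplification_algorithm d a k =
     \<lparr>anc_dim = d, init_state = outer (max_entangled d a),
      steps = Query # concat (replicate k (amplification_round d a)),
      success_effect = mat_diag (d * 2 ^ a) (\<lambda>k. if 2 ^ a dvd k then 1 else 0)\<rparr>"

lemma max_entangled_carrier: "max_entangled d a \<in> carrier_vec (d * (2 ^ a * d))"
  by (simp add: max_entangled_def)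

lemma max_entangled_norm:
  assumes "d > 0"
  shows "max_entangled d a \<bullet>c max_entangled d a = 1"
proof -
  let ?n = "2 ^ a * d"
  have "max_entangled d a \<bullet>c max_entangled d a =
      (\<Sum>i<d * ?n. if i mod ?n = i div ?n then complex_of_real (1 / real d) else 0)"
    by (auto simp: max_entangled_def scalar_prod_def atLeast0LessThan simp flip: of_real_mult
        intro!: sum.cong)
  also have "\<dots> = (\<Sum>k<d. \<Sum>t<?n. if t = k then complex_of_real (1 / real d) else 0)"
    by (rule sum_div_mod)
  also have "\<dots> = (\<Sum>k<d. complex_of_real (1 / real d))"
  proof (rule sum.cong[OF refl])
    fix k assume "k \<in> {..<d}"
    then have "k < ?n" by (simp add: less_le_trans)
    then show "(\<Sum>t<?n. if t = k then complex_of_real (1 / real d) else 0) = complex_of_real (1 / real d)"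
      by simp
  qed
  finally show ?thesis using assms by simp
qed

lemma query_count_amplification: "query_count (amplification_algorithm d a k) = 2 * k + 1"
proof -
  have "length (filter (\<lambda>s. s = Query \<or> s = Query_Adjoint)
      (concat (replicate k (amplification_round d a)))) = 2 * k"
    by (induction k) (auto simp: amplification_round_def)
  then show ?thesis by (simp add: query_count_def amplification_algorithm_def)
qed

lemma psd_mat_mat_diag:
  assumes "\<And>i. i < n \<Longrightarrow> 0 \<le> f i"
  shows "psd_mat n (mat_diag n f)"
proof -
  have real: "cnj (f i) = f i" if "i < n" for i
    using assms[OF that] by (auto simp: less_eq_complex_def complex_eq_iff)
  have "0 \<le> (mat_diag n f *\<^sub>v v) \<bullet>c v" if v: "v \<in> carrier_vec n" for v
  proof -
    have entry: "(mat_diag n f *\<^sub>v v) $ i = f i * v $ i" if "i < n" for i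
    proof -
      have "(mat_diag n f *\<^sub>v v) $ i = (\<Sum>j<n. (if i = j then f j else 0) * v $ j)"
        using that v by (simp add: mat_diag_def scalar_prod_def atLeast0LessThan)
      also have "\<dots> = (\<Sum>j\<in>{i}. (if i = j then f j else 0) * v $ j)"
        using that by (intro sum.mono_neutral_right) auto
      finally show ?thesis by simp
    qed
    have "(mat_diag n f *\<^sub>v v) \<bullet>c v = (\<Sum>i<n. f i * (v $ i * cnj (v $ i)))"
      using v by (simp add: scalar_prod_def[of _ "conjugate v"] entry atLeast0LessThan mult.assoc)
    also have "\<dots> \<ge> 0"
    proof (rule sum_nonneg)
      fix i assume "i \<in> {..<n}"
      then have "0 \<le> f i" using assms by simp
      moreover have "0 \<le> v $ i * cnj (v $ i)" by (simp add: less_eq_complex_def complex_mult_cnj)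
      ultimately show "0 \<le> f i * (v $ i * cnj (v $ i))" by (rule mult_nonneg_nonneg)
    qed
    finally show ?thesis .
  qed
  moreover have "mat_adjoint (mat_diag n f) = mat_diag n f"
    unfolding mat_adjoint_mat_diag using real by (auto simp: mat_diag_def)
  ultimately show ?thesis by (simp add: psd_mat_def)
qed

lemma valid_amplification_algorithm:
  assumes d: "d > 0"
  shows "valid_algorithm d a (amplification_algorithm d a k)"
proof -
  let ?m = "d * 2 ^ a" and ?N = "d * (2 ^ a * d)"
  have eq: "?m * d = ?N" by simp
  let ?E = "mat_diag ?m (\<lambda>k. if 2 ^ a dvd k then 1 else 0 :: complex)"
  have "unitary_mat ?N V" if "Fixed V \<in> set (amplification_round d a)" for V
    using that unitary_mat_reflection[OF max_entangled_carrier max_entangled_norm[OF d]]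
      unitary_mat_phase_flip[of ?N]
    by (auto simp: amplification_round_def)
  moreover have "1\<^sub>m ?m - ?E = mat_diag ?m (\<lambda>k. if 2 ^ a dvd k then 0 else 1)"
    by (intro eq_matI) (auto simp: mat_diag_def)
  moreover have "psd_mat ?m (mat_diag ?m (\<lambda>k. if 2 ^ a dvd k then 0 else 1))" "psd_mat ?m ?E"
    by (rule psd_mat_mat_diag, simp add: less_eq_complex_def)+
  moreover have "density_mat ?N (outer (max_entangled d a))"
    by (rule density_mat_outer[OF max_entangled_carrier max_entangled_norm[OF d]])
  ultimately show ?thesis
    using d by (auto simp: valid_algorithm_def rest_dim_def amplification_algorithm_def eq split: if_splits)
qed

text \<open>The induction generalises the vector \<open>w\<close>: \<open>fold\<close> consumes the
  first round first, whereas the iterate of \<open>G\<close> unfolds at its last application, and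
  \<open>funpow_swap1\<close> reconciles the two.\<close>

lemma fold_amplification_rounds:
  fixes U :: "complex mat" and d a :: nat
  defines "N \<equiv> d * (2 ^ a * d)" and "W \<equiv> kron (1\<^sub>m d) U"
  assumes U: "U \<in> carrier_mat (2 ^ a * d) (2 ^ a * d)" and w: "w \<in> carrier_vec N"
  defines "G \<equiv> \<lambda>z. W *\<^sub>v (reflection (max_entangled d a) *\<^sub>v
    (mat_adjoint W *\<^sub>v (phase_flip N (\<lambda>i. 2 ^ a dvd i div d) *\<^sub>v z)))"
  shows "fold (apply_step d U) (concat (replicate k (amplification_round d a))) (outer w) =
    outer ((G ^^ k) w)"
  using w
proof (induction k arbitrary: w)
  case (Suc k)
  have W: "W \<in> carrier_mat N N" "mat_adjoint W \<in> carrier_mat N N"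
    unfolding W_def N_def using kron_carrier[OF one_carrier_mat U] by (auto intro: mat_adjoint_carrier)
  have F: "phase_flip N P \<in> carrier_mat N N" for P by (simp add: phase_flip_def)
  have R: "reflection (max_entangled d a) \<in> carrier_mat N N"
    unfolding N_def by (rule reflection_carrier[OF max_entangled_carrier])
  have adj: "kron (1\<^sub>m d) (mat_adjoint U) = mat_adjoint W"
    by (simp add: W_def mat_adjoint_kron mat_adjoint_one)
  have "fold (apply_step d U) (amplification_round d a) (outer w) = outer (G w)"
    using W F R Suc.prems
    by (simp add: amplification_round_def conj_channel_outer[of _ N] mult_mat_vec_carrier[of _ N N] adj G_def
        flip: W_def N_def)
  moreover have "G w \<in> carrier_vec N" using W F R Suc.prems by (simp add: G_def mult_mat_vec_carrier[of _ N N])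
  ultimately show ?case using Suc.IH by (simp add: funpow_swap1)
qed simp

text \<open>Vectorisation of U: the ancilla value selects a column. Index k < d of the last two
  factors means qubits in state 0 and system in state k, so the ancilla value k is paired with that
  single vector, which U maps to its column k.\<close>

lemma kron_one_mult_max_entangled_index:
  assumes U: "U \<in> carrier_mat (2 ^ a * d) (2 ^ a * d)" and i: "i < d * (2 ^ a * d)"
  shows "(kron (1\<^sub>m d) U *\<^sub>v max_entangled d a) $ i =
    U $$ (i mod (2 ^ a * d), i div (2 ^ a * d)) * complex_of_real (1 / sqrt (real d))"
proof -
  define n where "n = 2 ^ a * d"
  define c where "c = complex_of_real (1 / sqrt (real d))"
  have U: "U \<in> carrier_mat n n" and i: "i < d * n" using assms by (auto simp: n_def)
  have div: "i div n < d" "i mod n < n" and dn: "d \<le> n"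
    using i by (auto simp: less_mult_imp_div_less n_def intro!: mod_less_divisor gr0I)
  have "(kron (1\<^sub>m d) U *\<^sub>v max_entangled d a) $ i =
      (\<Sum>t<d * n. kron (1\<^sub>m d) U $$ (i, t) * max_entangled d a $ t)"
    using i kron_carrier[OF one_carrier_mat U, of d]
    by (simp add: scalar_prod_def atLeast0LessThan max_entangled_def n_def)
  also have "\<dots> = (\<Sum>t<d * n. (1\<^sub>m d $$ (i div n, t div n) * U $$ (i mod n, t mod n)) *
      (if t mod n = t div n then c else 0))"
  proof (rule sum.cong[OF refl])
    fix t assume "t \<in> {..<d * n}"
    then have t: "t < d * n" by simp
    then have "max_entangled d a $ t = (if t mod n = t div n then c else 0)"
      by (simp add: max_entangled_def n_def c_def)
    then show "kron (1\<^sub>m d) U $$ (i, t) * max_entangled d a $ t =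
        (1\<^sub>m d $$ (i div n, t div n) * U $$ (i mod n, t mod n)) * (if t mod n = t div n then c else 0)"
      by (simp only: kron_index[OF one_carrier_mat U i t])
  qed
  also have "\<dots> = (\<Sum>k<d. \<Sum>t<n. (1\<^sub>m d $$ (i div n, k) * U $$ (i mod n, t)) * (if t = k then c else 0))"
    by (rule sum_div_mod)
  also have "\<dots> = (\<Sum>k<d. 1\<^sub>m d $$ (i div n, k) * U $$ (i mod n, k) * c)"
  proof (rule sum.cong[OF refl])
    fix k assume "k \<in> {..<d}"
    then have k: "k < n" using dn by simp
    have "(\<Sum>t<n. (1\<^sub>m d $$ (i div n, k) * U $$ (i mod n, t)) * (if t = k then c else 0)) =
        (\<Sum>t\<in>{k}. (1\<^sub>m d $$ (i div n, k) * U $$ (i mod n, t)) * (if t = k then c else 0))"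
      using k by (intro sum.mono_neutral_right) auto
    then show "(\<Sum>t<n. (1\<^sub>m d $$ (i div n, k) * U $$ (i mod n, t)) * (if t = k then c else 0)) =
        1\<^sub>m d $$ (i div n, k) * U $$ (i mod n, k) * c" by simp
  qed
  also have "\<dots> = (\<Sum>k\<in>{i div n}. 1\<^sub>m d $$ (i div n, k) * U $$ (i mod n, k) * c)"
    using div by (intro sum.mono_neutral_right) auto
  also have "\<dots> = U $$ (i mod n, i div n) * c" using div by simp
  finally show ?thesis by (simp add: n_def c_def)
qed

text \<open>The effect removes every entry carrying y. On the others, ancilla value k holds column k
  of \<rho>, scaled by x / (\<alpha> sqrt d). Tracing out the ancilla sums the products of these
  columns with their conjugates, giving \<rho> times its adjoint.\<close>

lemma ptrace_fst_amplified:
  fixes \<rho> U :: "complex mat" and x y \<alpha> :: real and d a :: nat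
  defines "v \<equiv> kron (1\<^sub>m d) U *\<^sub>v max_entangled d a"
  defines "w \<equiv> vec (d * (2 ^ a * d))
    (\<lambda>i. complex_of_real (if 2 ^ a dvd i div d then x else y) * v $ i)"
  assumes be: "block_encoding d \<alpha> a U \<rho>" and \<alpha>: "\<alpha> > 0" and d: "d > 0"
    and \<rho>: "\<rho> \<in> carrier_mat d d" and herm: "mat_adjoint \<rho> = \<rho>"
  shows "ptrace_fst (d * 2 ^ a) d
      (kron (mat_diag (d * 2 ^ a) (\<lambda>k. if 2 ^ a dvd k then 1 else 0)) (1\<^sub>m d) * outer w) =
    complex_of_real (x\<^sup>2 / (\<alpha>\<^sup>2 * real d)) \<cdot>\<^sub>m (\<rho> * \<rho>)"
proof (rule eq_matI)
  define n where "n = 2 ^ a * d"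
  have U: "U \<in> carrier_mat n n" using be by (auto simp: block_encoding_def unitary_mat_def n_def)
  have w: "w \<in> carrier_vec (d * n)" by (simp add: w_def n_def)
  have eq: "d * 2 ^ a * d = d * n" by (simp add: n_def)
  let ?M = "kron (mat_diag (d * 2 ^ a) (\<lambda>k. if 2 ^ a dvd k then 1 else 0)) (1\<^sub>m d) * outer w"
  have M: "?M = mat (d * n) (d * n)
      (\<lambda>(i, j). (if 2 ^ a dvd i div d then 1 else 0) * outer w $$ (i, j))"
    unfolding kron_mat_diag_one eq by (rule mat_diag_mult_left[OF outer_carrier[OF w]])
  fix i j assume "i < dim_row (complex_of_real (x\<^sup>2 / (\<alpha>\<^sup>2 * real d)) \<cdot>\<^sub>m (\<rho> * \<rho>))"
    "j < dim_col (complex_of_real (x\<^sup>2 / (\<alpha>\<^sup>2 * real d)) \<cdot>\<^sub>m (\<rho> * \<rho>))"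
  then have i: "i < d" and j: "j < d" using \<rho> by auto
  define u where "u = (\<lambda>i j k. complex_of_real (x\<^sup>2 / real d) * (U $$ (i, k) * cnj (U $$ (j, k))))"
  have v_entry: "w $ (k * d + l) = complex_of_real (x / sqrt (real d)) * U $$ (l, k div 2 ^ a)"
    if l: "l < d" and k: "k < d * 2 ^ a" "k mod 2 ^ a = 0" for k l
  proof -
    have kd: "k * d + l = (k div 2 ^ a) * n + l"
      using k(2) by (metis add_0_right div_mult_mod_eq mult.assoc n_def)
    have ln: "l < n" using l by (simp add: n_def less_le_trans)
    have "k * d + l < Suc k * d" using l by simp
    also have "\<dots> \<le> d * 2 ^ a * d" using k(1) by (intro mult_le_mono1) simp
    finally have bound: "k * d + l < d * n" by (simp add: eq)
    have "(k * d + l) div d = k" using l by simp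
    moreover have "(k * d + l) mod n = l" "(k * d + l) div n = k div 2 ^ a"
      using ln by (simp_all add: kd)
    moreover have "2 ^ a dvd k" using k(2) by (simp add: mod_eq_0_iff_dvd)
    ultimately show ?thesis
      using bound kron_one_mult_max_entangled_index[of U a d "k * d + l"] U
      by (simp add: w_def v_def n_def)
  qed
  have "ptrace_fst (d * 2 ^ a) d ?M $$ (i, j) = (\<Sum>k<d * 2 ^ a. ?M $$ (k * d + i, k * d + j))"
    using i j by (simp add: ptrace_fst_def)
  also have "\<dots> = (\<Sum>k<d * 2 ^ a. if k mod 2 ^ a = 0 then u i j (k div 2 ^ a) else 0)"
  proof (rule sum.cong[OF refl])
    fix k assume "k \<in> {..<d * 2 ^ a}"
    then have k: "k < d * 2 ^ a" by simp
    have bound: "k * d + l < d * n" if "l < d" for l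
    proof -
      have "k * d + l < Suc k * d" using that by simp
      also have "\<dots> \<le> d * 2 ^ a * d" using k by (intro mult_le_mono1) simp
      finally show ?thesis by (simp add: eq)
    qed
    have "?M $$ (k * d + i, k * d + j) =
        (if 2 ^ a dvd k then w $ (k * d + i) * cnj (w $ (k * d + j)) else 0)"
      using bound[OF i] bound[OF j] i j w unfolding M by (simp add: outer_def)
    also have "\<dots> = (if k mod 2 ^ a = 0 then u i j (k div 2 ^ a) else 0)"
    proof (cases "k mod 2 ^ a = 0")
      case True
      define z where "z = complex_of_real (x / sqrt (real d))"
      have "w $ (k * d + i) * cnj (w $ (k * d + j)) = (z * cnj z) * (U $$ (i, k div 2 ^ a) * cnj (U $$ (j, k div 2 ^ a)))"
        unfolding v_entry[OF i k True] v_entry[OF j k True] z_def[symmetric] by simp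
      also have "z * cnj z = complex_of_real (x\<^sup>2 / real d)"
        unfolding z_def complex_norm_square[symmetric] norm_of_real power2_abs
        by (simp add: power_divide del: of_real_divide of_real_power)
      finally show ?thesis using True by (simp add: u_def mod_eq_0_iff_dvd)
    qed (simp add: mod_eq_0_iff_dvd)
    finally show "?M $$ (k * d + i, k * d + j) =
        (if k mod 2 ^ a = 0 then u i j (k div 2 ^ a) else 0)" .
  qed
  \<comment> \<open>The traced index splits into ancilla and qubits, and only qubit index 0
    survives.\<close>
  also have "\<dots> = (\<Sum>k<d. \<Sum>q<(2 :: nat) ^ a. if q = 0 then u i j k else 0)"
    by (rule sum_div_mod)
  also have "\<dots> = (\<Sum>k<d. u i j k)" by (simp add: sum.delta)
  also have "\<dots> = (\<Sum>k<d. complex_of_real (x\<^sup>2 / (\<alpha>\<^sup>2 * real d)) * (\<rho> $$ (i, k) * \<rho> $$ (k, j)))"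
  proof (rule sum.cong[OF refl])
    fix k assume "k \<in> {..<d}"
    then have k: "k < d" by simp
    have "\<rho> $$ (k, j) = cnj (\<rho> $$ (j, k))"
      using arg_cong[OF herm, of "\<lambda>A. A $$ (k, j)"] k j \<rho> by (simp add: mat_adjoint_eq)
    then show "u i j k = complex_of_real (x\<^sup>2 / (\<alpha>\<^sup>2 * real d)) * (\<rho> $$ (i, k) * \<rho> $$ (k, j))"
      using \<alpha> d by (simp add: u_def block_encoding_index[OF be i k] block_encoding_index[OF be j k]
          field_simps power2_eq_square)
  qed
  also have "\<dots> = complex_of_real (x\<^sup>2 / (\<alpha>\<^sup>2 * real d)) * (\<Sum>k<d. \<rho> $$ (i, k) * \<rho> $$ (k, j))"
    by (simp only: sum_distrib_left)
  also have "\<dots> = (complex_of_real (x\<^sup>2 / (\<alpha>\<^sup>2 * real d)) \<cdot>\<^sub>m (\<rho> * \<rho>)) $$ (i, j)"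
    using \<rho> i j by (simp add: scalar_prod_def atLeast0LessThan)
  finally show "ptrace_fst (d * 2 ^ a) d ?M $$ (i, j) =
      (complex_of_real (x\<^sup>2 / (\<alpha>\<^sup>2 * real d)) \<cdot>\<^sub>m (\<rho> * \<rho>)) $$ (i, j)" .
qed (use \<rho> in \<open>auto simp: ptrace_fst_def\<close>)

text \<open>One angle serves all k. A nonzero success probability is required for the output because
  \<open>output_state\<close> would otherwise divide by 0.\<close>

lemma amplification_algorithm_run:
  fixes \<rho> U :: "complex mat" and \<alpha> S :: real and d a :: nat
  assumes be: "block_encoding d \<alpha> a U \<rho>" and \<alpha>: "\<alpha> > 0" and d: "d > 0"
    and \<rho>: "\<rho> \<in> carrier_mat d d" and herm: "mat_adjoint \<rho> = \<rho>"
    and tr: "mat_trace (\<rho> * \<rho>) = complex_of_real S" and S: "S > 0"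
  obtains \<theta> where "0 \<le> \<theta>" "\<theta> \<le> pi / 2" "(sin \<theta>)\<^sup>2 = S / (\<alpha>\<^sup>2 * real d)"
    "\<And>k. success_prob d (amplification_algorithm d a k) U = (sin ((2 * real k + 1) * \<theta>))\<^sup>2"
    "\<And>k. success_prob d (amplification_algorithm d a k) U \<noteq> 0 \<Longrightarrow>
       output_state d a (amplification_algorithm d a k) U = complex_of_real (1 / S) \<cdot>\<^sub>m (\<rho> * \<rho>)"
proof -
  define N where "N = d * (2 ^ a * d)"
  define \<psi> where "\<psi> = max_entangled d a"
  define W where "W = kron (1\<^sub>m d) U"
  define v where "v = W *\<^sub>v \<psi>"
  define P where "P = (\<lambda>i. 2 ^ a dvd i div d)"
  define w where "w = (\<lambda>x y. vec N (\<lambda>i. complex_of_real (if P i then x else y) * v $ i))"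
  define E :: "complex mat" where "E = mat_diag (d * 2 ^ a) (\<lambda>k. if 2 ^ a dvd k then 1 else 0)"
  define G where "G = (\<lambda>z. W *\<^sub>v (reflection \<psi> *\<^sub>v (mat_adjoint W *\<^sub>v (phase_flip N P *\<^sub>v z))))"
  have eq: "d * 2 ^ a * d = N" by (simp add: N_def)
  have U: "unitary_mat (2 ^ a * d) U" using be by (simp add: block_encoding_def)
  then have Uc: "U \<in> carrier_mat (2 ^ a * d) (2 ^ a * d)" by (simp add: unitary_mat_def)
  have W: "unitary_mat N W" unfolding N_def W_def by (rule unitary_mat_kron_one[OF U])
  then have Wc: "W \<in> carrier_mat N N" by (simp add: unitary_mat_def)
  have \<psi>: "\<psi> \<in> carrier_vec N" "\<psi> \<bullet>c \<psi> = 1"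
    unfolding \<psi>_def N_def by (rule max_entangled_carrier, rule max_entangled_norm[OF d])
  have v: "v \<in> carrier_vec N" using Wc \<psi> by (simp add: v_def)
  have EC: "kron E (1\<^sub>m d) \<in> carrier_mat N N"
    unfolding E_def kron_mat_diag_one eq by simp
  have ptrace: "ptrace_fst (d * 2 ^ a) d (kron E (1\<^sub>m d) * outer (w x y)) =
      complex_of_real (x\<^sup>2 / (\<alpha>\<^sup>2 * real d)) \<cdot>\<^sub>m (\<rho> * \<rho>)" for x y
    unfolding E_def w_def N_def P_def v_def W_def \<psi>_def
    by (rule ptrace_fst_amplified[OF be \<alpha> d \<rho> herm])
  have trace: "mat_trace (kron E (1\<^sub>m d) * outer (w x y)) =
      complex_of_real (x\<^sup>2 * (S / (\<alpha>\<^sup>2 * real d)))" for x y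
  proof -
    have "w x y \<in> carrier_vec N" by (simp add: w_def)
    then have "kron E (1\<^sub>m d) * outer (w x y) \<in> carrier_mat (d * 2 ^ a * d) (d * 2 ^ a * d)"
      unfolding eq using EC outer_carrier by auto
    from mat_trace_ptrace_fst[OF this]
    have "mat_trace (kron E (1\<^sub>m d) * outer (w x y)) =
        mat_trace (complex_of_real (x\<^sup>2 / (\<alpha>\<^sup>2 * real d)) \<cdot>\<^sub>m (\<rho> * \<rho>))"
      unfolding ptrace by simp
    also have "\<dots> = complex_of_real (x\<^sup>2 / (\<alpha>\<^sup>2 * real d)) * mat_trace (\<rho> * \<rho>)"
      using \<rho> by (simp add: mat_trace_def sum_distrib_left)
    finally show ?thesis using tr by simp
  qed
  define s where "s = (\<Sum>i | i < N \<and> P i. (cmod (v $ i))\<^sup>2)"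
  have s_eq: "s = S / (\<alpha>\<^sup>2 * real d)"
  proof -
    \<comment> \<open>Scaling both parts by 1 gives the unamplified state, so \<open>trace\<close>
      evaluates its good weight s.\<close>
    have w1: "w 1 1 = v" using v by (intro eq_vecI) (auto simp: w_def)
    have "kron E (1\<^sub>m d) * outer v =
        mat N N (\<lambda>(i, j). (if P i then 1 else 0) * outer v $$ (i, j))"
      unfolding E_def kron_mat_diag_one eq P_def by (rule mat_diag_mult_left[OF outer_carrier[OF v]])
    then have "mat_trace (kron E (1\<^sub>m d) * outer v) =
        (\<Sum>i<N. (if P i then 1 else 0) * outer v $$ (i, i))"
      by (simp add: mat_trace_def)
    also have "\<dots> = (\<Sum>i<N. if P i then complex_of_real ((cmod (v $ i))\<^sup>2) else 0)"
    proof (rule sum.cong[OF refl])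
      fix i assume "i \<in> {..<N}"
      then have "outer v $$ (i, i) = complex_of_real ((cmod (v $ i))\<^sup>2)"
        using v unfolding complex_norm_square by (simp add: outer_def)
      then show "(if P i then 1 else 0) * outer v $$ (i, i) =
          (if P i then complex_of_real ((cmod (v $ i))\<^sup>2) else 0)" by simp
    qed
    also have "\<dots> = (\<Sum>i | i < N \<and> P i. complex_of_real ((cmod (v $ i))\<^sup>2))"
      by (intro sum.mono_neutral_cong_right) auto
    also have "\<dots> = complex_of_real s" unfolding s_def by simp
    finally show ?thesis using trace[of 1 1] unfolding w1 by (simp del: of_real_divide of_real_mult)
  qed
  \<comment> \<open>Unitarity of W gives total weight 1, hence s \<le> 1, as \<open>arcsin\<close>
    needs.\<close>
  have "complex_of_real (\<Sum>i<N. (cmod (v $ i))\<^sup>2) = v \<bullet>c v"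
    using v by (simp add: scalar_prod_def atLeast0LessThan complex_norm_square del: of_real_power)
  also have "\<dots> = 1" using scalar_prod_unitary[OF W \<psi>(1) \<psi>(1)] \<psi>(2) by (simp add: v_def)
  finally have total: "(\<Sum>i<N. (cmod (v $ i))\<^sup>2) = 1" using of_real_eq_1_iff by blast
  have "s \<le> (\<Sum>i<N. (cmod (v $ i))\<^sup>2)" unfolding s_def by (intro sum_mono2) auto
  then have s1: "s \<le> 1" by (simp add: total)
  have s0: "0 \<le> s" by (simp add: s_def sum_nonneg)
  define \<theta> where "\<theta> = arcsin (sqrt s)"
  have sqrt_s: "0 \<le> sqrt s" "sqrt s \<le> 1" "- 1 \<le> sqrt s"
    using s0 s1 by (auto intro: order_trans[of _ 0])
  have \<theta>: "0 \<le> \<theta>" "\<theta> \<le> pi / 2"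
    using sqrt_s arcsin_le_arcsin[of 0 "sqrt s"] arcsin_le_arcsin[OF sqrt_s(3,2)] by (auto simp: \<theta>_def)
  have sin: "(sin \<theta>)\<^sup>2 = s" using sqrt_s s0 by (simp add: \<theta>_def)
  have final: "\<exists>x y. final_state (amplification_algorithm d a k) U = outer (w x y) \<and>
      x * sin \<theta> = sin ((2 * real k + 1) * \<theta>)" for k
  proof -
    have "final_state (amplification_algorithm d a k) U =
        fold (apply_step d U) (concat (replicate k (amplification_round d a))) (outer v)"
      using conj_channel_outer[OF Wc \<psi>(1)]
      by (simp add: final_state_def amplification_algorithm_def v_def flip: W_def \<psi>_def)
    also have "\<dots> = outer ((G ^^ k) v)"
      using v unfolding G_def P_def N_def W_def \<psi>_def
      by (intro fold_amplification_rounds[OF Uc]) simp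
    finally have "final_state (amplification_algorithm d a k) U = outer ((G ^^ k) v)" .
    moreover have "\<exists>x y. (G ^^ k) v = w x y \<and> x * sin \<theta> = sin ((2 * real k + 1) * \<theta>) \<and>
        y * cos \<theta> = cos ((2 * real k + 1) * \<theta>)"
      unfolding G_def w_def v_def
      by (rule amplification_iterate[OF W \<psi>]) (use sin in \<open>simp add: s_def v_def\<close>)
    ultimately show ?thesis by metis
  qed
  have fields: "success_effect (amplification_algorithm d a k) = E"
    "rest_dim a (amplification_algorithm d a k) = d * 2 ^ a" for k
    by (simp_all add: amplification_algorithm_def rest_dim_def E_def)
  have prob: "\<exists>x y. final_state (amplification_algorithm d a k) U = outer (w x y) \<and>
      success_prob d (amplification_algorithm d a k) U = x\<^sup>2 * s \<and>
      success_prob d (amplification_algorithm d a k) U = (sin ((2 * real k + 1) * \<theta>))\<^sup>2" for k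
  proof -
    obtain x y where f: "final_state (amplification_algorithm d a k) U = outer (w x y)"
      and x: "x * sin \<theta> = sin ((2 * real k + 1) * \<theta>)" using final by blast
    have "success_prob d (amplification_algorithm d a k) U = x\<^sup>2 * s"
      unfolding success_prob_def fields f trace s_eq by (rule Re_complex_of_real)
    moreover have "x\<^sup>2 * s = (sin ((2 * real k + 1) * \<theta>))\<^sup>2"
      unfolding x[symmetric] sin[symmetric] by (simp add: power_mult_distrib)
    ultimately show ?thesis using f by metis
  qed
  have out: "output_state d a (amplification_algorithm d a k) U = complex_of_real (1 / S) \<cdot>\<^sub>m (\<rho> * \<rho>)"
    if p: "success_prob d (amplification_algorithm d a k) U \<noteq> 0" for k
  proof -
    obtain x y where f: "final_state (amplification_algorithm d a k) U = outer (w x y)"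
      and x: "success_prob d (amplification_algorithm d a k) U = x\<^sup>2 * s" using prob by blast
    have "output_state d a (amplification_algorithm d a k) U =
        complex_of_real (1 / (x\<^sup>2 * s)) \<cdot>\<^sub>m (complex_of_real (x\<^sup>2 / (\<alpha>\<^sup>2 * real d)) \<cdot>\<^sub>m (\<rho> * \<rho>))"
      unfolding output_state_def fields f x ptrace ..
    also have "\<dots> = complex_of_real (1 / (x\<^sup>2 * s) * (x\<^sup>2 / (\<alpha>\<^sup>2 * real d))) \<cdot>\<^sub>m (\<rho> * \<rho>)"
      unfolding of_real_mult by (intro eq_matI) auto
    \<comment> \<open>The amplification factor cancels here; the nonzero probability ensures that x
      is not 0.\<close>
    also have "1 / (x\<^sup>2 * s) * (x\<^sup>2 / (\<alpha>\<^sup>2 * real d)) = 1 / S"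
      using p \<alpha> d S unfolding x s_eq by (auto simp: field_simps)
    finally show ?thesis .
  qed
  show thesis
  proof (rule that[OF \<theta>])
    show "(sin \<theta>)\<^sup>2 = S / (\<alpha>\<^sup>2 * real d)" using sin s_eq by simp
    show "success_prob d (amplification_algorithm d a k) U = (sin ((2 * real k + 1) * \<theta>))\<^sup>2" for k
      using prob by blast
  qed (rule out)
qed

section \<open>The number of rounds\<close>

text \<open>A weak form of Jordan's inequality. For y = t / 2, monotonicity of sin x - x cos x (its
  derivative is x sin x) gives y cos y \<le> sin y. Multiplying by 2 cos y yields sin t \<ge> y (1 +
  cos t) \<ge> y.\<close>

lemma half_le_sin:
  fixes t :: real
  assumes t: "0 \<le> t" "t \<le> pi / 2"
  shows "t / 2 \<le> sin t"
proof -
  define y where "y = t / 2"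
  have y: "0 \<le> y" "y \<le> pi" using t by (auto simp: y_def)
  define g where "g = (\<lambda>x :: real. sin x - x * cos x)"
  have "g 0 \<le> g y"
  proof (rule DERIV_nonneg_imp_nondecreasing[OF y(1)])
    fix x assume x: "0 \<le> x" "x \<le> y"
    have "(g has_real_derivative x * sin x) (at x)"
      unfolding g_def by (auto intro!: derivative_eq_intros)
    moreover have "0 \<le> x * sin x" using x y by (intro mult_nonneg_nonneg sin_ge_zero) auto
    ultimately show "\<exists>z. (g has_real_derivative z) (at x) \<and> 0 \<le> z" by blast
  qed
  then have "y * cos y \<le> sin y" by (simp add: g_def)
  moreover have c: "0 \<le> cos y" using t by (intro cos_ge_zero) (auto simp: y_def)
  ultimately have "2 * (y * cos y) * cos y \<le> 2 * sin y * cos y" by (intro mult_right_mono) auto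
  also have "\<dots> = sin t" using sin_double[of y] by (simp add: y_def)
  finally have "y * (2 * (cos y)\<^sup>2) \<le> sin t" by (simp add: power2_eq_square mult_ac)
  moreover have "2 * (cos y)\<^sup>2 = 1 + cos t" using cos_double_cos[of y] by (simp add: y_def)
  moreover have "y * 1 \<le> y * (1 + cos t)"
    using y t by (intro mult_left_mono) (auto intro: cos_ge_zero)
  ultimately have "y \<le> sin t" by simp
  then show ?thesis by (simp add: y_def)
qed

text \<open>Below, \<open>u\<close> approximates \<open>sin \<theta>\<close> up to a factor 2, so \<open>\<theta> \<le> 2 * sin \<theta> \<le> 4 * u\<close>. The choice of
  \<open>rounds u\<close> keeps the amplified angle at most \<open>1 < pi / 2\<close> unless no round is performed.\<close>

definition rounds :: "real \<Rightarrow> nat" where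
  "rounds u = nat \<lfloor>(1 / (4 * u) - 1) / 2\<rfloor>"

text \<open>The odd number n = 2 k + 1 is the largest with n u \<le> 1 / 4, if there is one. The
  next odd number n + 2 exceeds the bound and is at most 3 n, whence 1 / 12. For larger u the
  truncation by \<open>nat\<close> gives k = 0, which is the exceptional case of the second
  claim.\<close>

lemma rounds_bounds:
  assumes u: "u > 0"
  shows "1 / 12 \<le> (2 * real (rounds u) + 1) * u"
    and "rounds u = 0 \<or> (2 * real (rounds u) + 1) * u \<le> 1 / 4"
proof -
  let ?z = "(1 / (4 * u) - 1) / 2"
  let ?n = "2 * real (rounds u) + 1"
  have "?z < real (rounds u) + 1" unfolding rounds_def by linarith
  then have "1 / (4 * u) < ?n + 2" by (simp add: field_simps)
  then have "1 / 4 < (?n + 2) * u" using u by (simp add: field_simps)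
  also have "\<dots> \<le> (?n * 3) * u" using u by (intro mult_right_mono) auto
  finally show "1 / 12 \<le> ?n * u" by (simp add: algebra_simps)
  show "rounds u = 0 \<or> ?n * u \<le> 1 / 4"
  proof (cases "rounds u = 0")
    case False
    then have "real (rounds u) \<le> ?z" unfolding rounds_def by linarith
    then have "?n \<le> 1 / (4 * u)" by simp
    then have "?n * u \<le> 1 / 4" using u by (simp add: field_simps)
    then show ?thesis ..
  qed simp
qed

text \<open>From n u \<ge> 1 / 12 and \<theta> \<ge> u / 2 the amplified angle is at least 1 / 24.
  It does not pass pi / 2, so its sine is at least 1 / 48, whose square is 1 / 2304.\<close>

lemma sin_rounds_bound:
  assumes u: "u > 0" and \<theta>: "0 \<le> \<theta>" "\<theta> \<le> pi / 2"
    and lower: "u / 2 \<le> sin \<theta>" and upper: "sin \<theta> \<le> 2 * u"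
  shows "1 / 2304 \<le> (sin ((2 * real (rounds u) + 1) * \<theta>))\<^sup>2"
proof -
  let ?n = "2 * real (rounds u) + 1"
  have n: "0 \<le> ?n" by simp
  have "?n * \<theta> \<le> pi / 2"
    using rounds_bounds(2)[OF u]
  proof
    assume "rounds u = 0"
    then show ?thesis using \<theta> by simp
  next
    assume nu: "?n * u \<le> 1 / 4"
    have "\<theta> \<le> 4 * u" using half_le_sin[OF \<theta>] upper by simp
    then have "?n * \<theta> \<le> ?n * (4 * u)" using n by (rule mult_left_mono)
    also have "\<dots> \<le> 1" using nu by simp
    finally show ?thesis using pi_ge_two by simp
  qed
  then have "?n * \<theta> / 2 \<le> sin (?n * \<theta>)" using \<theta> by (intro half_le_sin) auto
  moreover have "?n * (u / 2) \<le> ?n * \<theta>"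
    using lower sin_x_le_x[OF \<theta>(1)] n by (intro mult_left_mono) auto
  ultimately have "1 / 48 \<le> sin (?n * \<theta>)" using rounds_bounds(1)[OF u] by argo
  then have "(1 / 48)\<^sup>2 \<le> (sin (?n * \<theta>))\<^sup>2" by (intro power_mono) auto
  then show ?thesis by (simp add: power2_eq_square)
qed

theorem corollary6:
  shows "\<exists>C p :: real. C > 0 \<and> p > 0 \<and>
    (\<forall>(d::nat) (r::nat) (a::nat) (\<alpha>::real) (\<kappa>::real) (\<epsilon>'::real) (\<epsilon>::real).
       1 \<le> r \<and> r \<le> d \<and> a > 0 \<and> \<alpha> > 0 \<and> 1 \<le> \<kappa> \<and> \<kappa> < 2 \<and>
       \<epsilon>' = \<kappa> - 1 \<and> 0 < \<epsilon> \<and> \<epsilon> < 1 \<and> \<epsilon> \<ge> \<epsilon>' \<longrightarrow>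
       (\<exists>alg. valid_algorithm d a alg \<and>
          (\<forall>\<rho> U.
             density_mat d \<rho> \<and> vec_space.rank d \<rho> = r \<and>
             lambda_max \<rho> / lambda_min \<rho> = \<kappa> \<and>
             block_encoding d \<alpha> a U \<rho> \<longrightarrow>
             real (query_count alg) \<le> C * (\<alpha> / lambda_max \<rho>) * sqrt (real d / real r) \<and>
             success_prob d alg U \<ge> p \<and>
             trace_norm (output_state d a alg U - \<rho>) \<le> \<epsilon>)))"
\<comment> \<open>The constant 4 is a product of two factors 2: the number of queries is at most 2 /
  u, and r times \<open>lambda_max\<close> is at most \<kappa> < 2. The probability comes from
  \<open>sin_rounds_bound\<close>.\<close>
proof (rule exI[of _ 4], rule exI[of _ "1 / 2304"], intro conjI allI impI)
  fix d r a :: nat and \<alpha> \<kappa> \<epsilon>' \<epsilon> :: real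
  assume *: "1 \<le> r \<and> r \<le> d \<and> a > 0 \<and> \<alpha> > 0 \<and> 1 \<le> \<kappa> \<and> \<kappa> < 2 \<and>
    \<epsilon>' = \<kappa> - 1 \<and> 0 < \<epsilon> \<and> \<epsilon> < 1 \<and> \<epsilon> \<ge> \<epsilon>'"
  then have r: "1 \<le> r" and d: "d > 0" and \<alpha>: "\<alpha> > 0" and \<kappa>: "1 \<le> \<kappa>" "\<kappa> < 2" "\<kappa> - 1 \<le> \<epsilon>" by auto
  \<comment> \<open>The value of sin \<theta> if S were exactly 1 / r; it uses only parameters known
    in advance.\<close>
  define u where "u = 1 / (\<alpha> * sqrt (real r * real d))"
  define alg where "alg = amplification_algorithm d a (rounds u)"
  have u: "u > 0" using r d \<alpha> by (simp add: u_def)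
  have u2: "u\<^sup>2 = 1 / (\<alpha>\<^sup>2 * (real r * real d))"
    using r d by (simp add: u_def power_divide power_mult_distrib)
  have "real (query_count alg) \<le> 4 * (\<alpha> / lambda_max \<rho>) * sqrt (real d / real r) \<and>
      success_prob d alg U \<ge> 1 / 2304 \<and> trace_norm (output_state d a alg U - \<rho>) \<le> \<epsilon>"
    if dens: "density_mat d \<rho>" and rank: "vec_space.rank d \<rho> = r"
      and cond: "lambda_max \<rho> / lambda_min \<rho> = \<kappa>" and be: "block_encoding d \<alpha> a U \<rho>" for \<rho> U
  proof -
    define S where "S = Re (mat_trace (\<rho> * \<rho>))"
    define M where "M = lambda_max \<rho>"
    note spec = density_mat_spectral_bounds[OF dens cond, folded S_def M_def, unfolded rank]
    have \<rho>: "\<rho> \<in> carrier_mat d d" "mat_adjoint \<rho> = \<rho>"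
      using dens by (auto simp: density_mat_def psd_mat_def)
    have rM: "1 \<le> real r * M" "real r * M \<le> 2" using spec(5,6) \<kappa> by auto
    have S: "0 < S"
      using less_le_trans[OF spec(2,3)] \<kappa> by (auto simp: zero_less_mult_iff)
    have "\<kappa> * S \<le> 2 * S" using S \<kappa> by (intro mult_right_mono) auto
    then have "M \<le> 2 * S" using spec(3) by linarith
    then have "1 \<le> real r * (2 * S)" using rM(1) mult_left_mono[of M "2 * S" "real r"] by simp
    moreover have "real r * S \<le> 2" using spec(4) rM(2) mult_left_mono[of S M "real r"] by simp
    \<comment> \<open>Weakened from 1 / 2 and 2 to perfect squares, so that taking roots leaves sin
      \<theta> between u / 2 and 2 u.\<close>
    ultimately have rS: "1 / 4 \<le> real r * S" "real r * S \<le> 4" by auto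
    obtain \<theta> where \<theta>: "0 \<le> \<theta>" "\<theta> \<le> pi / 2" and sin: "(sin \<theta>)\<^sup>2 = S / (\<alpha>\<^sup>2 * real d)"
      and prob: "\<And>k. success_prob d (amplification_algorithm d a k) U =
        (sin ((2 * real k + 1) * \<theta>))\<^sup>2"
      and out: "\<And>k. success_prob d (amplification_algorithm d a k) U \<noteq> 0 \<Longrightarrow>
        output_state d a (amplification_algorithm d a k) U = complex_of_real (1 / S) \<cdot>\<^sub>m (\<rho> * \<rho>)"
      by (rule amplification_algorithm_run[OF be \<alpha> d \<rho> spec(1) S]) (rule that; blast)
    have sin0: "0 \<le> sin \<theta>" using \<theta> by (intro sin_ge_zero) auto
    have sin_u: "(sin \<theta>)\<^sup>2 = u\<^sup>2 * (real r * S)" using r d \<alpha> by (simp add: sin u2 field_simps)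
    have "(u / 2)\<^sup>2 \<le> (sin \<theta>)\<^sup>2"
      using mult_left_mono[OF rS(1), of "u\<^sup>2"] unfolding sin_u by (simp add: power_divide)
    then have lower: "u / 2 \<le> sin \<theta>" using sin0 by (rule power2_le_imp_le)
    have "(sin \<theta>)\<^sup>2 \<le> (2 * u)\<^sup>2"
      using mult_left_mono[OF rS(2), of "u\<^sup>2"] unfolding sin_u by (simp add: power_mult_distrib)
    then have upper: "sin \<theta> \<le> 2 * u" by (rule power2_le_imp_le) (use u in simp)
    have p: "1 / 2304 \<le> success_prob d alg U"
      unfolding alg_def prob by (rule sin_rounds_bound[OF u \<theta> lower upper])
    then have "output_state d a alg U = complex_of_real (1 / S) \<cdot>\<^sub>m (\<rho> * \<rho>)"
      unfolding alg_def by (intro out) auto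
    then have err: "trace_norm (output_state d a alg U - \<rho>) \<le> \<epsilon>" using spec(7) \<kappa> by simp
    have "real (query_count alg) * u \<le> 2"
    proof -
      \<comment> \<open>Covers the case without rounds, where the single query costs u; otherwise
        the product is at most 1 / 4.\<close>
      have "u \<le> 2" using lower sin_le_one[of \<theta>] by linarith
      moreover have "real (query_count alg) = 2 * real (rounds u) + 1"
        by (simp add: alg_def query_count_amplification)
      ultimately show ?thesis using rounds_bounds(2)[OF u] by auto
    qed
    then have "real (query_count alg) \<le> 2 / u" using u by (simp add: field_simps)
    also have "\<dots> = 2 * \<alpha> * sqrt (real r * real d)" by (simp add: u_def)
    also have "sqrt (real r * real d) = real r * sqrt (real d / real r)"
    proof -
      have "real r * real d = (real r)\<^sup>2 * (real d / real r)" using r by (simp add: power2_eq_square)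
      then show ?thesis by (simp only: real_sqrt_mult real_sqrt_abs abs_of_nat)
    qed
    also have "2 * \<alpha> * (real r * sqrt (real d / real r)) \<le> 2 * \<alpha> * (2 / M * sqrt (real d / real r))"
      using rM(2) spec(2) \<alpha> by (intro mult_left_mono mult_right_mono) (auto simp: field_simps)
    finally have "real (query_count alg) \<le> 4 * (\<alpha> / M) * sqrt (real d / real r)" by (simp add: field_simps)
    then show ?thesis using p err by (simp add: M_def)
  qed
  moreover have "valid_algorithm d a alg" unfolding alg_def by (rule valid_amplification_algorithm[OF d])
  ultimately show "\<exists>alg. valid_algorithm d a alg \<and>
      (\<forall>\<rho> U. density_mat d \<rho> \<and> vec_space.rank d \<rho> = r \<and>
        lambda_max \<rho> / lambda_min \<rho> = \<kappa> \<and> block_encoding d \<alpha> a U \<rho> \<longrightarrow>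
        real (query_count alg) \<le> 4 * (\<alpha> / lambda_max \<rho>) * sqrt (real d / real r) \<and>
        success_prob d alg U \<ge> 1 / 2304 \<and> trace_norm (output_state d a alg U - \<rho>) \<le> \<epsilon>)"
    by blast
qed simp_all

end
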